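(* Let $p>1$. The Faber--Schauder coefficient map $$\mathscr C_p:\mathcal E^p\to\mathfrak e^p,\qquad \mathscr C_pf:=\Big(f(0),\big(\theta^f_{n,k}\big)_{n\in\mathbb N_{-1},\,k\in I_n}\Big),$$ is a Banach space isomorphism (a bounded linear bijection between Banach spaces with bounded inverse). Its inverse is the reconstruction map $$\mathscr R_p(c,a)(t):=c+\sum_{n=-1}^\infty\sum_{k\in I_n}a_{n,k}e_{n,k}(t),\qquad t\in[0,1].$$
   Context: $C([0,1])$ denotes the real-valued continuous functions on $[0,1]$, $\|\cdot\|_\infty$ the uniform norm. $\mathbb N_0=\{0,1,2,\dots\}$, $\mathbb N_{-1}=\{-1,0,1,\dots\}$. For $n\in\mathbb N_0$: $t_{n,k}=k2^{-n}$ for $0\le k\le 2^n$, $I_n=\{0,\dots,2^n-1\}$; also $I_{-1}=\{0\}$. Haar and Faber--Schauder functions: $\psi=1$ on $[0,\frac12)$, $\psi=-1$ on $[\frac12,1)$, $\psi=0$ otherwise; $\psi_{n,k}(t)=2^{n/2}\psi(2^nt-k)$ for $n\ge0$, $k\in I_n$; $\psi_{-1,0}(t)=1$ on $[0,1]$; $e_{n,k}(t)=\int_0^t\psi_{n,k}(s)\,ds$ for $n\in\mathbb N_{-1}$, $k\in I_n$. Faber--Schauder coefficients of $f\in C([0,1])$: $\theta^f_{-1,0}=f(1)-f(0)$, and for $n\ge0$, $k\in I_n$, $\theta^f_{n,k}=2^{n/2}\big(2f(t_{n+1,2k+1})-f(t_{n,k})-f(t_{n,k+1})\big)$. For a real coefficient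 family $a=(a_{n,k})_{n\in\mathbb N_{-1},k\in I_n}$ and $p>1$: $\zeta_a^{(p)}(-1)=2^{1-\frac1p}|a_{-1,0}|$, $\zeta_a^{(p)}(n)=\big(2^{-np/2}\sum_{k\in I_n}|a_{n,k}|^p\big)^{1/p}$ for $n\ge0$, and $H_a(n)=\sum_{m=n}^\infty2^{-m/2}\sup_{k\in I_m}|a_{m,k}|\in[0,\infty]$ for $n\ge0$. For $f\in C([0,1])$, $\zeta_f^{(p)}:=\zeta_a^{(p)}$ and $H_f:=H_a$ with $a=(\theta^f_{n,k})$. Energy space ($p>1$): $\|f\|_{\mathcal E^p}=\|f\|_\infty+\|\zeta_f^{(p)}\|_{\ell^p(\mathbb N_{-1})}+\|H_f\|_{\ell^p(\mathbb N_0)}$ and $\mathcal E^p=\{f\in C([0,1]):\|f\|_{\mathcal E^p}<\infty\}$. Coefficient energy space: $\mathfrak e^p=\{(c,a):c\in\mathbb R,\ \zeta_a^{(p)}\in\ell^p(\mathbb N_{-1}),\ H_a\in\ell^p(\mathbb N_0)\}$ with norm $\|(c,a)\|_{\mathfrak e^p}=|c|+\|\zeta_a^{(p)}\|_{\ell^p(\mathbb N_{-1})}+\|H_a\|_{\ell^p(\mathbb N_0)}$. *)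

theory Defs
  imports "HOL-Analysis.Analysis" "HOL-Library.Function_Algebras"
begin

section \<open>Normed spaces carried by a subspace\<close>

text \<open>The energy spaces depend on the real number \<open>p\<close>, so they cannot be instances of the class
  \<^class>\<open>banach\<close>. They are linear subspaces \<open>V\<close> of a fixed vector space of functions, together with
  a function \<open>N\<close> that is a norm on \<open>V\<close> (its values outside \<open>V\<close> are irrelevant).\<close>

instantiation "fun" :: (type, real_vector) real_vector
begin

definition scaleR_fun :: "real \<Rightarrow> ('a \<Rightarrow> 'b) \<Rightarrow> 'a \<Rightarrow> 'b"
  where "scaleR_fun r f = (\<lambda>x. r *\<^sub>R f x)"

instance
  by standard (simp_all add: scaleR_fun_def plus_fun_def fun_eq_iff scaleR_add_right scaleR_add_left)

end

definition normed_space_on :: "'v::real_vector set \<Rightarrow> ('v \<Rightarrow> real) \<Rightarrow> bool" where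
  "normed_space_on V N \<longleftrightarrow> subspace V \<and>
     (\<forall>x\<in>V. 0 \<le> N x \<and> (N x = 0 \<longleftrightarrow> x = 0)) \<and>
     (\<forall>x\<in>V. \<forall>y\<in>V. N (x + y) \<le> N x + N y) \<and>
     (\<forall>r. \<forall>x\<in>V. N (r *\<^sub>R x) = \<bar>r\<bar> * N x)"

definition banach_space_on :: "'v::real_vector set \<Rightarrow> ('v \<Rightarrow> real) \<Rightarrow> bool" where
  "banach_space_on V N \<longleftrightarrow> normed_space_on V N \<and>
     (\<forall>s. (\<forall>i::nat. s i \<in> V) \<and> (\<forall>\<epsilon>>0. \<exists>M. \<forall>i\<ge>M. \<forall>j\<ge>M. N (s i - s j) < \<epsilon>)
        \<longrightarrow> (\<exists>l\<in>V. (\<lambda>i. N (s i - l)) \<longlonglongrightarrow> 0))"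

definition bounded_linear_between ::
  "'v::real_vector set \<Rightarrow> ('v \<Rightarrow> real) \<Rightarrow> 'w::real_vector set \<Rightarrow> ('w \<Rightarrow> real) \<Rightarrow> ('v \<Rightarrow> 'w) \<Rightarrow> bool" where
  "bounded_linear_between V N W N' T \<longleftrightarrow> T \<in> V \<rightarrow> W \<and>
     (\<forall>x\<in>V. \<forall>y\<in>V. T (x + y) = T x + T y) \<and>
     (\<forall>r. \<forall>x\<in>V. T (r *\<^sub>R x) = r *\<^sub>R T x) \<and>
     (\<exists>K. \<forall>x\<in>V. N' (T x) \<le> K * N x)"

definition banach_space_isomorphism ::
  "'v::real_vector set \<Rightarrow> ('v \<Rightarrow> real) \<Rightarrow> 'w::real_vector set \<Rightarrow> ('w \<Rightarrow> real) \<Rightarrow> ('v \<Rightarrow> 'w) \<Rightarrow> bool" where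
  "banach_space_isomorphism V N W N' T \<longleftrightarrow>
     banach_space_on V N \<and> banach_space_on W N' \<and>
     bounded_linear_between V N W N' T \<and> bij_betw T V W \<and>
     bounded_linear_between W N' V N (inv_into V T)"

section \<open>Haar and Faber--Schauder functions\<close>

text \<open>Levels are integers \<open>n \<ge> -1\<close>.\<close>

definition level_idx :: "int \<Rightarrow> nat set" where
  "level_idx n = (if n = -1 then {0} else if 0 \<le> n then {..<2 ^ nat n} else {})"

definition dyadic :: "int \<Rightarrow> nat \<Rightarrow> real" where
  "dyadic n k = real k * 2 powi (- n)"

definition haar_mother :: "real \<Rightarrow> real" where
  "haar_mother t = (if 0 \<le> t \<and> t < 1/2 then 1 else if 1/2 \<le> t \<and> t < 1 then -1 else 0)"

definition haar :: "int \<Rightarrow> nat \<Rightarrow> real \<Rightarrow> real" where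
  "haar n k t = (if n = -1 then indicator {0..1} t
     else 2 powr (of_int n / 2) * haar_mother (2 powi n * t - real k))"

definition faber_schauder :: "int \<Rightarrow> nat \<Rightarrow> real \<Rightarrow> real" where
  "faber_schauder n k t = integral {0..t} (haar n k)"

text \<open>\<open>C([0,1])\<close>: a continuous function on \<open>[0,1]\<close> is represented by its extension by \<open>0\<close>,
  so that equality in the type is equality on \<open>[0,1]\<close>.\<close>

definition C01 :: "(real \<Rightarrow> real) set" where
  "C01 = {f. continuous_on {0..1} f \<and> (\<forall>t. t \<notin> {0..1} \<longrightarrow> f t = 0)}"

text \<open>Likewise, a family \<open>(a\<^bsub>n,k\<^esub>)\<close> with \<open>n \<ge> -1\<close> and \<open>k \<in> I\<^sub>n\<close> is represented by its extension by \<open>0\<close>.\<close>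

definition coeff_families :: "(int \<Rightarrow> nat \<Rightarrow> real) set" where
  "coeff_families = {a. \<forall>n k. k \<notin> level_idx n \<longrightarrow> a n k = 0}"

definition fs_coeff :: "(real \<Rightarrow> real) \<Rightarrow> int \<Rightarrow> nat \<Rightarrow> real" where
  "fs_coeff f n k =
     (if k \<notin> level_idx n then 0
      else if n = -1 then f 1 - f 0
      else 2 powr (of_int n / 2) *
             (2 * f (dyadic (n + 1) (2 * k + 1)) - f (dyadic n k) - f (dyadic n (k + 1))))"

section \<open>Energy spaces\<close>

text \<open>The power \<open>x\<^sup>r\<close> for \<open>x \<in> [0,\<infinity>]\<close> and \<open>r > 0\<close>.\<close>

definition ennpowr :: "ennreal \<Rightarrow> real \<Rightarrow> ennreal" where
  "ennpowr x r = (if x = \<infinity> then \<infinity> else ennreal (enn2real x powr r))"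

definition lp_norm :: "real \<Rightarrow> 'i set \<Rightarrow> ('i \<Rightarrow> ennreal) \<Rightarrow> ennreal" where
  "lp_norm p A x = ennpowr (\<Sum>\<^sub>\<infinity>i\<in>A. ennpowr (x i) p) (1 / p)"

definition zeta_coeff :: "real \<Rightarrow> (int \<Rightarrow> nat \<Rightarrow> real) \<Rightarrow> int \<Rightarrow> real" where
  "zeta_coeff p a n =
     (if n = -1 then 2 powr (1 - 1 / p) * \<bar>a (-1) 0\<bar>
      else (2 powr (- (of_int n * p / 2)) * (\<Sum>k\<in>level_idx n. \<bar>a n k\<bar> powr p)) powr (1 / p))"

definition H_coeff :: "(int \<Rightarrow> nat \<Rightarrow> real) \<Rightarrow> int \<Rightarrow> ennreal" where
  "H_coeff a n = (\<Sum>\<^sub>\<infinity>m\<in>{n..}. ennreal (2 powr (- (of_int m / 2)) * (SUP k\<in>level_idx m. \<bar>a m k\<bar>)))"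

definition zeta_lp :: "real \<Rightarrow> (int \<Rightarrow> nat \<Rightarrow> real) \<Rightarrow> ennreal" where
  "zeta_lp p a = lp_norm p {-1..} (\<lambda>n. ennreal (zeta_coeff p a n))"

definition H_lp :: "real \<Rightarrow> (int \<Rightarrow> nat \<Rightarrow> real) \<Rightarrow> ennreal" where
  "H_lp p a = lp_norm p {0..} (H_coeff a)"

definition energy_enorm :: "real \<Rightarrow> (real \<Rightarrow> real) \<Rightarrow> ennreal" where
  "energy_enorm p f =
     (SUP t\<in>{0..1}. ennreal \<bar>f t\<bar>) + zeta_lp p (fs_coeff f) + H_lp p (fs_coeff f)"

definition energy_space :: "real \<Rightarrow> (real \<Rightarrow> real) set" where
  "energy_space p = {f \<in> C01. energy_enorm p f < \<infinity>}"

definition energy_norm :: "real \<Rightarrow> (real \<Rightarrow> real) \<Rightarrow> real" where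
  "energy_norm p f = enn2real (energy_enorm p f)"

definition coeff_energy_space :: "real \<Rightarrow> (real \<times> (int \<Rightarrow> nat \<Rightarrow> real)) set" where
  "coeff_energy_space p = {(c, a). a \<in> coeff_families \<and> zeta_lp p a < \<infinity> \<and> H_lp p a < \<infinity>}"

definition coeff_energy_norm :: "real \<Rightarrow> real \<times> (int \<Rightarrow> nat \<Rightarrow> real) \<Rightarrow> real" where
  "coeff_energy_norm p = (\<lambda>(c, a). \<bar>c\<bar> + enn2real (zeta_lp p a) + enn2real (H_lp p a))"

definition coeff_map :: "(real \<Rightarrow> real) \<Rightarrow> real \<times> (int \<Rightarrow> nat \<Rightarrow> real)" where
  "coeff_map f = (f 0, fs_coeff f)"

text \<open>The contribution of level \<open>n\<close> to the Faber--Schauder series.\<close>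

definition fs_level :: "(int \<Rightarrow> nat \<Rightarrow> real) \<Rightarrow> int \<Rightarrow> real \<Rightarrow> real" where
  "fs_level a n t = (\<Sum>k\<in>level_idx n. a n k * faber_schauder n k t)"

text \<open>The outer series over \<open>n \<ge> -1\<close> is the limit of its partial sums; the summation index \<open>j\<close>
  below stands for the level \<open>n = j - 1\<close>.\<close>

definition reconstruction_map :: "real \<times> (int \<Rightarrow> nat \<Rightarrow> real) \<Rightarrow> real \<Rightarrow> real" where
  "reconstruction_map = (\<lambda>(c, a) t.
     if t \<in> {0..1} then c + (\<Sum>j. fs_level a (int j - 1) t) else 0)"

end

theory Submission
  imports Defs
begin

text \<open>
  Completeness rests on one observation: every summand of the two norms is built, by suprema and
  \<open>\<ell>\<^sup>q\<close> norms with \<open>q \<ge> 1\<close>, from absolute values of linear functionals that are continuous for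
  pointwise convergence. Hence it is a seminorm with values in \<open>[0,\<infinity>]\<close> which, as in Fatou's lemma, is sequentially
  lower semicontinuous for pointwise convergence. The class of such functionals (\<open>lsc_seminorm\<close>) is
  closed under sums, suprema and \<open>\<ell>\<^sup>q\<close> norms (\<open>lsc_seminorm_lp_norm\<close>, from Minkowski's inequality). The
  finite part of a definite one is a normed space, and it is complete as soon as every Cauchy
  sequence converges pointwise (\<open>banach_space_on_lsc_seminorm\<close>): if \<open>\<Phi> (s i - s j) < e\<close> for all large
  \<open>j\<close>, then \<open>\<Phi> (s i - l) \<le> e\<close> by semicontinuity. The coefficient energy space is of this kind, since
  its norm controls every single coefficient.

  The space of functions inherits completeness through the isomorphism
  (\<open>banach_space_isomorphismI\<close>), so what remains is that \<open>coeff_map\<close> is bijective with two-sided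
  bounds. The function \<open>e\<^bsub>n,k\<^esub>\<close> is a rescaled tent. At the three dyadic points that enter
  \<open>\<theta>\<^bsub>m,j\<^esub>\<close> it either vanishes (finer levels), is affine (coarser levels), or peaks at the midpoint
  exactly when the indices agree; so \<open>\<theta>\<^bsub>m,j\<^esub>(e\<^bsub>n,k\<^esub>)\<close> is a Kronecker delta (\<open>fs_coeff_faber_schauder\<close>).
  Since the tents of one level have disjoint interiors of their supports, level \<open>m \<ge> 0\<close> of the series is at most
  \<open>2\<^bsup>-m/2\<^esup> sup\<^sub>k \<bar>a\<^bsub>m,k\<^esub>\<bar>\<close>. The Weierstrass test therefore applies once \<open>H\<^sub>a(0) < \<infinity>\<close>. It gives a
  continuous sum whose coefficients are \<open>a\<close> (\<open>coeff_map_reconstruction_map\<close>) and whose uniform norm is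
  at most \<open>\<bar>c\<bar> + \<bar>a\<^bsub>-1,0\<^esub>\<bar> + H\<^sub>a(0)\<close>, hence at most the norm of \<open>(c, a)\<close>. As the other two parts of
  the energy norm are already parts of the coefficient norm, the inverse has norm at most \<open>2\<close>.
  Injectivity holds because a continuous function with \<open>f 0 = 0\<close> and vanishing coefficients vanishes at all dyadic
  points (\<open>fs_coeff_eq_0_imp_eq_0\<close>).
\<close>

section \<open>Extended-valued sequence norms\<close>

lemma ennpowr_ennreal: "0 \<le> x \<Longrightarrow> ennpowr (ennreal x) r = ennreal (x powr r)"
  by (simp add: ennpowr_def)

lemma ennpowr_top [simp]: "ennpowr \<infinity> r = \<infinity>" "ennpowr top r = top"
  by (simp_all add: ennpowr_def)

lemma ennpowr_mono: "0 < r \<Longrightarrow> x \<le> y \<Longrightarrow> ennpowr x r \<le> ennpowr y r"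
  by (cases x; cases y) (auto simp: ennpowr_ennreal top_unique intro!: ennreal_leI powr_mono2)

lemma ennpowr_one [simp]: "ennpowr x 1 = x"
  by (cases x) (auto simp: ennpowr_ennreal)

lemma ennpowr_ennpowr_inverse:
  assumes "0 < r"
  shows "ennpowr (ennpowr x r) (1 / r) = x" "ennpowr (ennpowr x (1 / r)) r = x"
  using assms by (cases x; auto simp: ennpowr_ennreal powr_powr)+

text \<open>For \<open>r > 0\<close> the power map is an order isomorphism of \<open>[0,\<infinity>]\<close>. Its compatibility with suprema and
  limits inferior below follows from this adjunction alone, without any continuity argument.\<close>

lemma ennpowr_le_iff: "0 < r \<Longrightarrow> ennpowr x r \<le> y \<longleftrightarrow> x \<le> ennpowr y (1 / r)"
  using ennpowr_mono[of r x "ennpowr y (1 / r)"] ennpowr_mono[of "1 / r" "ennpowr x r" y]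
  by (auto simp: ennpowr_ennpowr_inverse)

lemma less_ennpowr_iff: "0 < r \<Longrightarrow> y < ennpowr x r \<longleftrightarrow> ennpowr y (1 / r) < x"
  using ennpowr_le_iff[of r x y] by (auto simp flip: not_le)

lemma ennpowr_SUP:
  assumes "0 < r"
  shows "ennpowr (SUP i\<in>I. f i) r = (SUP i\<in>I. ennpowr (f i) r)"
proof (rule antisym)
  show "ennpowr (SUP i\<in>I. f i) r \<le> (SUP i\<in>I. ennpowr (f i) r)"
    unfolding ennpowr_le_iff[OF assms]
    by (rule SUP_least) (auto simp flip: ennpowr_le_iff[OF assms] intro: SUP_upper)
qed (intro SUP_least ennpowr_mono assms SUP_upper)

lemma ennpowr_mult: "0 < r \<Longrightarrow> ennpowr (ennreal c * x) r = ennpowr (ennreal c) r * ennpowr x r"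
proof (cases "c \<le> 0")
  case True
  assume "0 < r"
  then show ?thesis using True ennpowr_ennreal[of 0 r] by (simp add: ennreal_neg)
next
  case False
  assume "0 < r"
  then show ?thesis using False
    by (cases x) (auto simp: ennpowr_ennreal powr_mult ennreal_mult_top simp flip: ennreal_mult)
qed

lemma liminf_add_le:
  fixes u v :: "nat \<Rightarrow> ennreal"
  assumes "a \<le> liminf u" "b \<le> liminf v"
  shows "a + b \<le> liminf (\<lambda>i. u i + v i)"
proof -
  have "a + b \<le> liminf u + liminf v"
    using assms by (rule add_mono)
  also have "\<dots> = (SUP n. (INF m\<in>{n..}. u m) + (INF m\<in>{n..}. v m))"
    unfolding liminf_SUP_INF
    by (rule ennreal_SUP_add[symmetric]) (auto simp: incseq_def intro!: INF_superset_mono)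
  also have "\<dots> \<le> liminf (\<lambda>i. u i + v i)"
    unfolding liminf_SUP_INF
    by (intro SUP_mono) (auto intro!: INF_greatest add_mono INF_lower)
  finally show ?thesis .
qed

lemma liminf_sum_le:
  fixes u :: "'i \<Rightarrow> nat \<Rightarrow> ennreal"
  assumes "\<And>i. i \<in> F \<Longrightarrow> a i \<le> liminf (u i)"
  shows "(\<Sum>i\<in>F. a i) \<le> liminf (\<lambda>j. \<Sum>i\<in>F. u i j)"
  using assms
proof (induction F rule: infinite_finite_induct)
  case (insert i F)
  then show ?case using liminf_add_le[of "a i" "u i" "sum a F"] by simp
qed auto

lemma liminf_ennpowr_le:
  assumes "0 < r" "a \<le> liminf u"
  shows "ennpowr a r \<le> liminf (\<lambda>j. ennpowr (u j) r)"
  using assms by (auto simp: le_Liminf_iff less_ennpowr_iff)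

text \<open>Writing the \<open>\<ell>\<^sup>p\<close> norm as a supremum over finite index sets reduces all its properties to
  finite sums.\<close>

lemma lp_norm_SUP:
  assumes "0 < p"
  shows "lp_norm p A x = (SUP F\<in>{F. finite F \<and> F \<subseteq> A}. ennpowr (\<Sum>i\<in>F. ennpowr (x i) p) (1 / p))"
  using assms by (simp add: lp_norm_def nonneg_infsum_complete ennpowr_SUP)

lemma le_lp_norm:
  assumes "0 < p" "i \<in> A"
  shows "x i \<le> lp_norm p A x"
  unfolding lp_norm_SUP[OF assms(1)] using assms
  by (intro SUP_upper2[of "{i}"]) (auto simp: ennpowr_ennpowr_inverse)

lemma lp_norm_finite_real:
  assumes "finite F" "0 < p"
  shows "lp_norm p F (\<lambda>i. ennreal \<bar>x i\<bar>) = ennreal ((\<Sum>i\<in>F. \<bar>x i\<bar> powr p) powr (1 / p))"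
  using assms by (simp add: lp_norm_def ennpowr_ennreal sum_nonneg)

lemma infsum_eq_lp_norm: "(\<Sum>\<^sub>\<infinity>i\<in>A. x i) = lp_norm 1 A x"
  by (simp add: lp_norm_def)

text \<open>Convexity on the closed half-line. At the boundary point \<open>0\<close> it reduces to \<open>s powr p \<le> s\<close> for
  \<open>0 \<le> s \<le> 1\<close>.\<close>

lemma powr_convex_combination_le:
  "1 \<le> p \<Longrightarrow> 0 \<le> x \<Longrightarrow> 0 \<le> y \<Longrightarrow> 0 \<le> t \<Longrightarrow> t \<le> 1 \<Longrightarrow>
  ((1 - t) * x + t * y) powr p \<le> (1 - t) * x powr p + t * (y powr p)" for x y t p :: real
proof -
  assume a: "1 \<le> p" "0 \<le> x" "0 \<le> y" "0 \<le> t" "t \<le> 1"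
  have le: "s powr p \<le> s" if "0 \<le> s" "s \<le> 1" for s :: real
    using powr_mono'[of 1 p s] that a by simp
  consider "x = 0" | "y = 0" | "0 < x" "0 < y" using a by linarith
  then show ?thesis
  proof cases
    case 1
    then show ?thesis using a le[of t] by (simp add: powr_mult mult_right_mono)
  next
    case 2
    then show ?thesis using a le[of "1 - t"] by (simp add: powr_mult mult_right_mono)
  next
    case 3
    then show ?thesis
      using convex_onD[OF powr_convex[OF a(1)], of t x y] a by simp
  qed
qed

text \<open>If the two norms \<open>X\<close> and \<open>Y\<close> on the right are nonzero, \<open>(x + y) / (X + Y)\<close> is a convex combination of the
  normalized sequences \<open>x / X\<close> and \<open>y / Y\<close>, so the claim is convexity of \<open>\<lambda>s. s powr p\<close> summed over
  the indices.\<close>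

lemma minkowski_sum:
  fixes x y :: "'i \<Rightarrow> real"
  assumes p: "1 \<le> p" and F: "finite F" and nn: "\<And>i. i \<in> F \<Longrightarrow> 0 \<le> x i" "\<And>i. i \<in> F \<Longrightarrow> 0 \<le> y i"
  shows "(\<Sum>i\<in>F. (x i + y i) powr p) powr (1 / p)
    \<le> (\<Sum>i\<in>F. x i powr p) powr (1 / p) + (\<Sum>i\<in>F. y i powr p) powr (1 / p)"
proof -
  define X where "X = (\<Sum>i\<in>F. x i powr p) powr (1 / p)"
  define Y where "Y = (\<Sum>i\<in>F. y i powr p) powr (1 / p)"
  have XY: "0 \<le> X" "0 \<le> Y" by (simp_all add: X_def Y_def)
  have Xp: "X powr p = (\<Sum>i\<in>F. x i powr p)" and Yp: "Y powr p = (\<Sum>i\<in>F. y i powr p)"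
    using p by (simp_all add: X_def Y_def powr_powr sum_nonneg)
  have zero: "\<forall>i\<in>F. z i = 0" if "(\<Sum>i\<in>F. z i powr p) powr (1 / p) = 0" for z :: "'i \<Rightarrow> real"
    using that F by (simp add: sum_nonneg_eq_0_iff)
  consider "X = 0" | "Y = 0" | "0 < X" "0 < Y" using XY by linarith
  then have "(\<Sum>i\<in>F. (x i + y i) powr p) powr (1 / p) \<le> X + Y"
  proof cases
    case 1
    then have "\<forall>i\<in>F. x i = 0" using zero[of x] X_def by simp
    then show ?thesis using XY by (simp add: Y_def)
  next
    case 2
    then have "\<forall>i\<in>F. y i = 0" using zero[of y] Y_def by simp
    then show ?thesis using XY by (simp add: X_def)
  next
    case 3
    define t where "t = Y / (X + Y)"
    have t: "0 \<le> t" "t \<le> 1" "1 - t = X / (X + Y)"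
      using 3 by (auto simp: t_def field_simps)
    have "(\<Sum>i\<in>F. (x i + y i) powr p)
        = (\<Sum>i\<in>F. (X + Y) powr p * ((1 - t) * (x i / X) + t * (y i / Y)) powr p)"
    proof (rule sum.cong[OF refl])
      fix i assume "i \<in> F"
      have "(1 - t) * (x i / X) + t * (y i / Y) = (x i + y i) / (X + Y)"
        using 3 unfolding t(3) unfolding t_def by (simp add: add_divide_distrib)
      then show "(x i + y i) powr p = (X + Y) powr p * ((1 - t) * (x i / X) + t * (y i / Y)) powr p"
        using 3 nn[OF \<open>i \<in> F\<close>] by (simp add: powr_divide)
    qed
    also have "\<dots> \<le> (\<Sum>i\<in>F. (X + Y) powr p * ((1 - t) * (x i / X) powr p + t * (y i / Y) powr p))"
      using 3 t nn p by (intro sum_mono mult_left_mono powr_convex_combination_le) auto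
    also have "\<dots> = (X + Y) powr p * ((1 - t) * ((\<Sum>i\<in>F. x i powr p) / X powr p)
        + t * ((\<Sum>i\<in>F. y i powr p) / Y powr p))"
      using 3 nn by (simp add: powr_divide sum_divide_distrib sum_distrib_left sum.distrib distrib_left)
    also have "\<dots> = (X + Y) powr p"
      using 3 by (simp flip: Xp Yp)
    finally have "(\<Sum>i\<in>F. (x i + y i) powr p) powr (1 / p) \<le> ((X + Y) powr p) powr (1 / p)"
      using p by (intro powr_mono2) (auto intro: sum_nonneg)
    then show ?thesis using 3 p by (simp add: powr_powr)
  qed
  then show ?thesis by (simp add: X_def Y_def)
qed

text \<open>An infinite entry makes the right-hand side infinite; otherwise the real inequality applies.\<close>

lemma minkowski_ennreal:
  fixes x y :: "'i \<Rightarrow> ennreal"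
  assumes p: "1 \<le> p" and F: "finite F"
  shows "ennpowr (\<Sum>i\<in>F. ennpowr (x i + y i) p) (1 / p)
    \<le> ennpowr (\<Sum>i\<in>F. ennpowr (x i) p) (1 / p) + ennpowr (\<Sum>i\<in>F. ennpowr (y i) p) (1 / p)"
proof (cases "\<exists>i\<in>F. x i = \<infinity> \<or> y i = \<infinity>")
  case True
  then obtain i where "i \<in> F" "ennpowr (x i) p = \<infinity> \<or> ennpowr (y i) p = \<infinity>"
    by auto
  then have "(\<Sum>i\<in>F. ennpowr (x i) p) = \<infinity> \<or> (\<Sum>i\<in>F. ennpowr (y i) p) = \<infinity>"
    using F by (auto simp: ennreal_sum_eq_top)
  then show ?thesis by auto
next
  case False
  define u where "u i = enn2real (x i)" for i
  define v where "v i = enn2real (y i)" for i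
  have uv: "x i = ennreal (u i)" "y i = ennreal (v i)" if "i \<in> F" for i
    using False that by (auto simp: u_def v_def less_top)
  have nn: "0 \<le> u i" "0 \<le> v i" for i by (auto simp: u_def v_def)
  show ?thesis
    using minkowski_sum[OF p F, of u v] nn uv p
    by (simp add: ennpowr_ennreal sum_nonneg cong: sum.cong flip: ennreal_plus)
qed

section \<open>Lower semicontinuous seminorms\<close>

text \<open>The space carries two independent structures: its vector operations and a topology, in the
  application that of pointwise convergence, which is far weaker than the norm. Semicontinuity is
  only required along sequences.\<close>

definition lsc_seminorm :: "('v::{real_vector,topological_space} \<Rightarrow> ennreal) \<Rightarrow> bool" where
  "lsc_seminorm \<Phi> \<longleftrightarrow>
     (\<forall>x y. \<Phi> (x + y) \<le> \<Phi> x + \<Phi> y) \<and>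
     (\<forall>r x. \<Phi> (r *\<^sub>R x) = ennreal \<bar>r\<bar> * \<Phi> x) \<and>
     (\<forall>s x. s \<longlonglongrightarrow> x \<longrightarrow> \<Phi> x \<le> liminf (\<lambda>i. \<Phi> (s i)))"

lemma lsc_seminorm_abs:
  fixes l :: "'v::{real_vector,topological_space} \<Rightarrow> real"
  assumes "linear l" "continuous_on UNIV l"
  shows "lsc_seminorm (\<lambda>x. ennreal \<bar>l x\<bar>)"
  unfolding lsc_seminorm_def
proof (intro conjI allI impI)
  fix s :: "nat \<Rightarrow> 'v" and x assume "s \<longlonglongrightarrow> x"
  then have "(\<lambda>i. l (s i)) \<longlonglongrightarrow> l x"
    by (rule continuous_on_tendsto_compose[OF assms(2)]) auto
  then have "(\<lambda>i. ennreal \<bar>l (s i)\<bar>) \<longlonglongrightarrow> ennreal \<bar>l x\<bar>"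
    by (intro tendsto_ennrealI tendsto_rabs)
  then show "ennreal \<bar>l x\<bar> \<le> liminf (\<lambda>i. ennreal \<bar>l (s i)\<bar>)"
    by (metis lim_imp_Liminf order_refl trivial_limit_sequentially)
qed (use assms(1) in \<open>auto simp: linear_add linear_scale abs_mult
       simp flip: ennreal_plus ennreal_mult intro!: ennreal_leI\<close>)

lemma lsc_seminorm_add:
  assumes "lsc_seminorm \<Phi>" "lsc_seminorm \<Psi>"
  shows "lsc_seminorm (\<lambda>x. \<Phi> x + \<Psi> x)"
  unfolding lsc_seminorm_def
proof (intro conjI allI impI)
  fix x y
  have "\<Phi> (x + y) + \<Psi> (x + y) \<le> (\<Phi> x + \<Phi> y) + (\<Psi> x + \<Psi> y)"
    using assms by (intro add_mono) (auto simp: lsc_seminorm_def)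
  then show "\<Phi> (x + y) + \<Psi> (x + y) \<le> (\<Phi> x + \<Psi> x) + (\<Phi> y + \<Psi> y)"
    by (simp add: algebra_simps)
qed (use assms in \<open>auto simp: lsc_seminorm_def distrib_left intro: liminf_add_le\<close>)

text \<open>An arbitrary index set is allowed, which covers both the suprema in the norms and the passage
  from finite to infinite sums; an empty supremum is \<open>0\<close>.\<close>

lemma lsc_seminorm_SUP:
  fixes \<Phi> :: "'i \<Rightarrow> 'v::{real_vector,topological_space} \<Rightarrow> ennreal"
  assumes "\<And>i. i \<in> I \<Longrightarrow> lsc_seminorm (\<Phi> i)"
  shows "lsc_seminorm (\<lambda>x. SUP i\<in>I. \<Phi> i x)"
  unfolding lsc_seminorm_def
proof (intro conjI allI impI)
  fix x y
  show "(SUP i\<in>I. \<Phi> i (x + y)) \<le> (SUP i\<in>I. \<Phi> i x) + (SUP i\<in>I. \<Phi> i y)"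
  proof (rule SUP_least)
    fix i assume i: "i \<in> I"
    have "\<Phi> i (x + y) \<le> \<Phi> i x + \<Phi> i y" using assms[OF i] by (simp add: lsc_seminorm_def)
    also have "\<dots> \<le> (SUP i\<in>I. \<Phi> i x) + (SUP i\<in>I. \<Phi> i y)"
      using i by (intro add_mono SUP_upper)
    finally show "\<Phi> i (x + y) \<le> (SUP i\<in>I. \<Phi> i x) + (SUP i\<in>I. \<Phi> i y)" .
  qed
next
  fix r x
  show "(SUP i\<in>I. \<Phi> i (r *\<^sub>R x)) = ennreal \<bar>r\<bar> * (SUP i\<in>I. \<Phi> i x)"
    using assms by (simp add: lsc_seminorm_def SUP_mult_left_ennreal)
next
  fix s :: "nat \<Rightarrow> 'v" and x assume "s \<longlonglongrightarrow> x"
  show "(SUP i\<in>I. \<Phi> i x) \<le> liminf (\<lambda>j. SUP i\<in>I. \<Phi> i (s j))"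
  proof (rule SUP_least)
    fix i assume i: "i \<in> I"
    have "\<Phi> i x \<le> liminf (\<lambda>j. \<Phi> i (s j))"
      using assms[OF i] \<open>s \<longlonglongrightarrow> x\<close> by (simp add: lsc_seminorm_def)
    also have "\<dots> \<le> liminf (\<lambda>j. SUP i\<in>I. \<Phi> i (s j))"
      using i by (intro Liminf_mono always_eventually allI SUP_upper)
    finally show "\<Phi> i x \<le> liminf (\<lambda>j. SUP i\<in>I. \<Phi> i (s j))" .
  qed
qed

text \<open>Over a finite index set, subadditivity is Minkowski's inequality and semicontinuity is
  superadditivity of the limit inferior. The general case is a supremum of these.\<close>

lemma lsc_seminorm_lp_norm:
  fixes \<Phi> :: "'i \<Rightarrow> 'v::{real_vector,topological_space} \<Rightarrow> ennreal"
  assumes p: "1 \<le> p" and \<Phi>: "\<And>i. i \<in> A \<Longrightarrow> lsc_seminorm (\<Phi> i)"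
  shows "lsc_seminorm (\<lambda>x. lp_norm p A (\<lambda>i. \<Phi> i x))"
proof -
  have p0: "0 < p" "0 < 1 / p" using p by auto
  have "lsc_seminorm (\<lambda>x. ennpowr (\<Sum>i\<in>F. ennpowr (\<Phi> i x) p) (1 / p))"
    if F: "finite F" "F \<subseteq> A" for F
    unfolding lsc_seminorm_def
  proof (intro conjI allI impI)
    fix x y
    have "ennpowr (\<Sum>i\<in>F. ennpowr (\<Phi> i (x + y)) p) (1 / p)
        \<le> ennpowr (\<Sum>i\<in>F. ennpowr (\<Phi> i x + \<Phi> i y) p) (1 / p)"
      using F \<Phi> p0 by (intro ennpowr_mono sum_mono) (auto simp: lsc_seminorm_def)
    also have "\<dots> \<le> ennpowr (\<Sum>i\<in>F. ennpowr (\<Phi> i x) p) (1 / p)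
        + ennpowr (\<Sum>i\<in>F. ennpowr (\<Phi> i y) p) (1 / p)"
      by (rule minkowski_ennreal[OF p F(1)])
    finally show "ennpowr (\<Sum>i\<in>F. ennpowr (\<Phi> i (x + y)) p) (1 / p)
        \<le> ennpowr (\<Sum>i\<in>F. ennpowr (\<Phi> i x) p) (1 / p)
          + ennpowr (\<Sum>i\<in>F. ennpowr (\<Phi> i y) p) (1 / p)" .
  next
    fix r x
    have "(\<Sum>i\<in>F. ennpowr (\<Phi> i (r *\<^sub>R x)) p)
        = (\<Sum>i\<in>F. ennreal (\<bar>r\<bar> powr p) * ennpowr (\<Phi> i x) p)"
      using F \<Phi> p0 by (intro sum.cong)
        (auto simp: lsc_seminorm_def ennpowr_mult ennpowr_ennreal)
    then have "ennpowr (\<Sum>i\<in>F. ennpowr (\<Phi> i (r *\<^sub>R x)) p) (1 / p)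
        = ennpowr (ennreal (\<bar>r\<bar> powr p)) (1 / p) * ennpowr (\<Sum>i\<in>F. ennpowr (\<Phi> i x) p) (1 / p)"
      using p0 by (simp only: ennpowr_mult flip: sum_distrib_left)
    then show "ennpowr (\<Sum>i\<in>F. ennpowr (\<Phi> i (r *\<^sub>R x)) p) (1 / p)
        = ennreal \<bar>r\<bar> * ennpowr (\<Sum>i\<in>F. ennpowr (\<Phi> i x) p) (1 / p)"
      using p0 by (simp add: ennpowr_ennreal powr_powr)
  next
    fix s :: "nat \<Rightarrow> 'v" and x assume "s \<longlonglongrightarrow> x"
    then show "ennpowr (\<Sum>i\<in>F. ennpowr (\<Phi> i x) p) (1 / p)
        \<le> liminf (\<lambda>j. ennpowr (\<Sum>i\<in>F. ennpowr (\<Phi> i (s j)) p) (1 / p))"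
      using F \<Phi> p0 by (intro liminf_ennpowr_le liminf_sum_le) (auto simp: lsc_seminorm_def)
  qed
  then show ?thesis
    unfolding lp_norm_SUP[OF p0(1)] by (intro lsc_seminorm_SUP) auto
qed

lemma lsc_seminorm_compose:
  fixes T :: "'u::{real_vector,topological_space} \<Rightarrow> 'v::{real_vector,topological_space}"
  assumes "lsc_seminorm \<Phi>" "linear T" "continuous_on UNIV T"
  shows "lsc_seminorm (\<lambda>x. \<Phi> (T x))"
  unfolding lsc_seminorm_def
proof (intro conjI allI impI)
  fix s :: "nat \<Rightarrow> 'u" and x assume "s \<longlonglongrightarrow> x"
  then have "(\<lambda>i. T (s i)) \<longlonglongrightarrow> T x"
    by (rule continuous_on_tendsto_compose[OF assms(3)]) auto
  then show "\<Phi> (T x) \<le> liminf (\<lambda>i. \<Phi> (T (s i)))"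
    using assms(1) by (simp add: lsc_seminorm_def)
qed (use assms(1) in \<open>auto simp: lsc_seminorm_def linear_add[OF assms(2)] linear_scale[OF assms(2)]\<close>)

text \<open>The norm \<open>N\<close> is kept separate from \<open>\<Phi>\<close> because a real-valued norm may take other values off \<open>V\<close>.\<close>

lemma normed_space_on_lsc_seminorm:
  assumes \<Phi>: "lsc_seminorm \<Phi>" and S: "subspace S" and def: "\<And>x. x \<in> S \<Longrightarrow> \<Phi> x = 0 \<Longrightarrow> x = 0"
    and Veq: "V = {x \<in> S. \<Phi> x < \<infinity>}" and N: "\<And>x. x \<in> V \<Longrightarrow> N x = enn2real (\<Phi> x)"
  shows "normed_space_on V N"
proof -
  have add: "\<Phi> (x + y) \<le> \<Phi> x + \<Phi> y" and scale: "\<Phi> (r *\<^sub>R x) = ennreal \<bar>r\<bar> * \<Phi> x" for x y r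
    using \<Phi> by (auto simp: lsc_seminorm_def)
  have zero: "\<Phi> 0 = 0" using scale[of 0 0] by simp
  have V: "subspace V"
    unfolding subspace_def Veq using S zero scale
    by (auto simp: subspace_def ennreal_mult_less_top intro: le_less_trans[OF add])
  show ?thesis
    unfolding normed_space_on_def
  proof (intro conjI ballI allI V)
    fix x assume x: "x \<in> V"
    then show "0 \<le> N x" by (simp add: N)
    show "(N x = 0) = (x = 0)"
      using x def zero by (auto simp: N Veq enn2real_eq_0_iff)
  next
    fix x y assume xy: "x \<in> V" "y \<in> V"
    then have fin: "\<Phi> x < top" "\<Phi> y < top" by (auto simp: Veq)
    then have "enn2real (\<Phi> (x + y)) \<le> enn2real (\<Phi> x + \<Phi> y)"
      by (intro enn2real_mono add) auto
    then show "N (x + y) \<le> N x + N y"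
      using fin xy V by (simp add: N enn2real_plus subspace_add)
  next
    fix r x assume "x \<in> V"
    then show "N (r *\<^sub>R x) = \<bar>r\<bar> * N x"
      using V by (simp add: N subspace_scale scale enn2real_mult)
  qed
qed

text \<open>A Cauchy sequence for \<open>\<Phi>\<close> has a limit \<open>l\<close> in the ambient topology by hypothesis; semicontinuity, applied to
  \<open>j \<mapsto> s i - s j\<close>, upgrades this to convergence in \<open>\<Phi>\<close> and also shows that \<open>\<Phi> l\<close> is finite. Stating the
  limit through the differences \<open>s i - s j\<close> avoids assuming that subtraction is continuous.\<close>

lemma banach_space_on_lsc_seminorm:
  assumes \<Phi>: "lsc_seminorm \<Phi>" and S: "subspace S" and def: "\<And>x. x \<in> S \<Longrightarrow> \<Phi> x = 0 \<Longrightarrow> x = 0"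
    and lim: "\<And>s. (\<And>i. s i \<in> S) \<Longrightarrow> (\<And>e. 0 < e \<Longrightarrow> \<exists>M. \<forall>i\<ge>M. \<forall>j\<ge>M. \<Phi> (s i - s j) < ennreal e)
        \<Longrightarrow> \<exists>l\<in>S. \<forall>i. (\<lambda>j. s i - s j) \<longlonglongrightarrow> s i - l"
    and Veq: "V = {x \<in> S. \<Phi> x < \<infinity>}" and N: "\<And>x. x \<in> V \<Longrightarrow> N x = enn2real (\<Phi> x)"
  shows "banach_space_on V N"
  unfolding banach_space_on_def
proof (intro conjI allI impI normed_space_on_lsc_seminorm[OF \<Phi> S def Veq N])
  have V: "subspace V"
    using normed_space_on_lsc_seminorm[OF \<Phi> S def Veq N] by (simp add: normed_space_on_def)
  fix s assume "(\<forall>i::nat. s i \<in> V) \<and> (\<forall>\<epsilon>>0. \<exists>M. \<forall>i\<ge>M. \<forall>j\<ge>M. N (s i - s j) < \<epsilon>)"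
  then have s: "\<And>i. s i \<in> V"
    and c: "\<And>\<epsilon>. 0 < \<epsilon> \<Longrightarrow> \<exists>M. \<forall>i\<ge>M. \<forall>j\<ge>M. N (s i - s j) < \<epsilon>" by auto
  have Ns: "N (s i - s j) = enn2real (\<Phi> (s i - s j))" for i j
    by (rule N[OF subspace_diff[OF V s s]])
  have diff: "\<Phi> (s i - s j) < \<infinity>" for i j
    using subspace_diff[OF V s s, of i j] by (simp add: Veq)
  have c': "\<exists>M. \<forall>i\<ge>M. \<forall>j\<ge>M. \<Phi> (s i - s j) < ennreal e" if "0 < e" for e
    using c[OF that] diff unfolding Ns by (metis ennreal_enn2real ennreal_lessI infinity_ennreal_def that)
  obtain l where l: "l \<in> S" "\<And>i. (\<lambda>j. s i - s j) \<longlonglongrightarrow> s i - l"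
    using lim[of s] s c' by (auto simp: Veq)
  have close: "\<exists>M. \<forall>i\<ge>M. \<Phi> (s i - l) \<le> ennreal e" if e: "0 < e" for e
  proof -
    obtain M where M: "\<And>i j. i \<ge> M \<Longrightarrow> j \<ge> M \<Longrightarrow> \<Phi> (s i - s j) < ennreal e"
      using c'[OF e] by blast
    have "\<Phi> (s i - l) \<le> ennreal e" if "i \<ge> M" for i
    proof -
      have "\<Phi> (s i - l) \<le> liminf (\<lambda>j. \<Phi> (s i - s j))"
        using \<Phi> l(2) by (simp add: lsc_seminorm_def)
      also have "\<dots> \<le> liminf (\<lambda>j. ennreal e)"
        using M that by (intro Liminf_mono) (auto simp: eventually_sequentially intro!: exI[of _ M] less_imp_le)
      finally show ?thesis by (simp add: Liminf_const)
    qed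
    then show ?thesis by blast
  qed
  obtain M where "\<Phi> (s M - l) \<le> ennreal 1" using close[of 1] by auto
  then have "s M - l \<in> V"
    using s l S by (auto simp: Veq subspace_diff intro: le_less_trans)
  from subspace_diff[OF V s this] have lV: "l \<in> V" by (metis diff_diff_eq2 add_diff_cancel_left')
  have "(\<lambda>i. enn2real (\<Phi> (s i - l))) \<longlonglongrightarrow> 0"
  proof (rule LIMSEQ_I)
    fix r :: real assume "0 < r"
    then obtain M where "\<forall>i\<ge>M. \<Phi> (s i - l) \<le> ennreal (r / 2)" using close[of "r / 2"] by auto
    then have "\<forall>i\<ge>M. enn2real (\<Phi> (s i - l)) \<le> r / 2"
      using \<open>0 < r\<close> by (auto intro!: enn2real_leI simp del: le_divide_eq_numeral1)
    then show "\<exists>M. \<forall>i\<ge>M. norm (enn2real (\<Phi> (s i - l)) - 0) < r"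
      using \<open>0 < r\<close> by (intro exI[of _ M]) fastforce
  qed
  moreover have "N (s i - l) = enn2real (\<Phi> (s i - l))" for i
    by (rule N[OF subspace_diff[OF V s lV]])
  ultimately show "\<exists>l\<in>V. (\<lambda>i. N (s i - l)) \<longlonglongrightarrow> 0"
    using lV by (intro bexI[of _ l]) simp_all
qed

section \<open>Isomorphisms with a Banach space\<close>

text \<open>A bijection that is bounded in both directions carries Cauchy sequences to Cauchy sequences
  and limits back to limits, so completeness of \<open>W\<close> suffices.\<close>

lemma banach_space_isomorphismI:
  assumes V: "normed_space_on V N" and W: "banach_space_on W N'"
    and T: "bounded_linear_between V N W N' T" and bij: "bij_betw T V W"
    and K: "\<And>x. x \<in> V \<Longrightarrow> N x \<le> K * N' (T x)"
  shows "banach_space_isomorphism V N W N' T"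
proof -
  have subV: "subspace V" and subW: "subspace W" and normW: "normed_space_on W N'"
    using V W by (auto simp: normed_space_on_def banach_space_on_def)
  have TW: "T x \<in> W" if "x \<in> V" for x using T that by (auto simp: bounded_linear_between_def)
  have Tadd: "T (x + y) = T x + T y" if "x \<in> V" "y \<in> V" for x y
    using T that by (auto simp: bounded_linear_between_def)
  have Tscale: "T (r *\<^sub>R x) = r *\<^sub>R T x" if "x \<in> V" for r x
    using T that by (auto simp: bounded_linear_between_def)
  have Tdiff: "T (x - y) = T x - T y" if "x \<in> V" "y \<in> V" for x y
    using Tadd[of x "- 1 *\<^sub>R y"] Tscale[of y "-1"] that subV by (simp add: subspace_neg)
  have "\<exists>L. \<forall>x\<in>V. N' (T x) \<le> L * N x" using T by (simp add: bounded_linear_between_def)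
  then obtain L where L: "\<And>x. x \<in> V \<Longrightarrow> N' (T x) \<le> L * N x" by blast
  have inj: "inj_on T V" using bij by (simp add: bij_betw_def)
  have inv: "inv_into V T y \<in> V" "T (inv_into V T y) = y" if "y \<in> W" for y
    using bij that by (auto simp: bij_betw_def inv_into_into f_inv_into_f)
  have invT: "inv_into V T (T x) = x" if "x \<in> V" for x
    using inj that by (rule inv_into_f_f)
  have "bounded_linear_between W N' V N (inv_into V T)"
    unfolding bounded_linear_between_def
  proof (intro conjI allI ballI)
    fix x y assume "x \<in> W" "y \<in> W"
    then show "inv_into V T (x + y) = inv_into V T x + inv_into V T y"
      using invT[of "inv_into V T x + inv_into V T y"] inv subV by (simp add: Tadd subspace_add)
  next
    fix r x assume "x \<in> W"
    then show "inv_into V T (r *\<^sub>R x) = r *\<^sub>R inv_into V T x"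
      using invT[of "r *\<^sub>R inv_into V T x"] inv subV by (simp add: Tscale subspace_scale)
  next
    show "\<exists>K. \<forall>x\<in>W. N (inv_into V T x) \<le> K * N' x"
      using K inv by metis
  qed (use inv in auto)
  moreover have "banach_space_on V N"
    unfolding banach_space_on_def
  proof (intro conjI allI impI V)
    fix s assume "(\<forall>i::nat. s i \<in> V) \<and> (\<forall>\<epsilon>>0. \<exists>M. \<forall>i\<ge>M. \<forall>j\<ge>M. N (s i - s j) < \<epsilon>)"
    then have s: "\<And>i. s i \<in> V" and c: "\<And>\<epsilon>. 0 < \<epsilon> \<Longrightarrow> \<exists>M. \<forall>i\<ge>M. \<forall>j\<ge>M. N (s i - s j) < \<epsilon>" by auto
    have nn: "0 \<le> N x" if "x \<in> V" for x using V that by (simp add: normed_space_on_def)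
    have "\<forall>\<epsilon>>0. \<exists>M. \<forall>i\<ge>M. \<forall>j\<ge>M. N' (T (s i) - T (s j)) < \<epsilon>"
    proof (intro allI impI)
      fix e :: real assume e: "0 < e"
      \<comment> \<open>\<open>L\<close> may be zero or negative, and the argument divides by it\<close>
      define L' where "L' = max L 1"
      obtain M where M: "\<And>i j. i \<ge> M \<Longrightarrow> j \<ge> M \<Longrightarrow> N (s i - s j) < e / L'"
        using c[of "e / L'"] e by (auto simp: L'_def)
      have "N' (T (s i) - T (s j)) < e" if ij: "i \<ge> M" "j \<ge> M" for i j
      proof -
        have d: "s i - s j \<in> V" using s subV by (simp add: subspace_diff)
        have "N' (T (s i - s j)) \<le> L * N (s i - s j)" by (rule L[OF d])
        also have "\<dots> \<le> L' * N (s i - s j)"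
          using nn[OF d] by (intro mult_right_mono) (auto simp: L'_def)
        also have "\<dots> < e"
          using M[OF ij] by (simp add: L'_def field_simps)
        finally show ?thesis using s by (simp add: Tdiff)
      qed
      then show "\<exists>M. \<forall>i\<ge>M. \<forall>j\<ge>M. N' (T (s i) - T (s j)) < e" by blast
    qed
    moreover have "\<forall>i. T (s i) \<in> W" using s TW by blast
    ultimately have "\<exists>l\<in>W. (\<lambda>i. N' (T (s i) - l)) \<longlonglongrightarrow> 0"
      using W unfolding banach_space_on_def by (elim conjE allE[of _ "\<lambda>i. T (s i)"]) simp
    then obtain l where l: "l \<in> W" "(\<lambda>i. N' (T (s i) - l)) \<longlonglongrightarrow> 0" by blast
    define x where "x = inv_into V T l"
    have x: "x \<in> V" "T x = l" using inv[OF l(1)] by (auto simp: x_def)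
    have "(\<lambda>i. N (s i - x)) \<longlonglongrightarrow> 0"
    proof (rule tendsto_sandwich[OF _ _ tendsto_const])
      show "(\<lambda>i. K * N' (T (s i) - l)) \<longlonglongrightarrow> 0"
        using tendsto_mult_left[OF l(2), of K] by simp
      have d: "s i - x \<in> V" for i using s x subV by (simp add: subspace_diff)
      show "\<forall>\<^sub>F i in sequentially. N (s i - x) \<le> K * N' (T (s i) - l)"
        using K[OF d] s x by (simp add: Tdiff)
      show "\<forall>\<^sub>F i in sequentially. 0 \<le> N (s i - x)"
        using nn[OF d] by simp
    qed
    then show "\<exists>l\<in>V. (\<lambda>i. N (s i - l)) \<longlonglongrightarrow> 0" using x by blast
  qed
  ultimately show ?thesis
    using W T bij by (simp add: banach_space_isomorphism_def)
qed

section \<open>Faber--Schauder functions and their coefficients\<close>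

text \<open>The primitive of the Haar mother function that vanishes at \<open>0\<close>.\<close>

definition tent :: "real \<Rightarrow> real" where
  "tent x = max 0 (min x (1 - x))"

lemma tent_nonneg: "0 \<le> tent x" and tent_le_1: "tent x \<le> 1"
  by (auto simp: tent_def)

lemma tent_eq_0: "x \<le> 0 \<or> 1 \<le> x \<Longrightarrow> tent x = 0"
  by (auto simp: tent_def)

lemma tent_of_int: "tent (of_int i) = 0"
  by (rule tent_eq_0) (metis int_one_le_iff_zero_less not_le of_int_1_le_iff of_int_le_0_iff)

lemma continuous_on_tent: "continuous_on A tent"
  unfolding tent_def by (intro continuous_intros)

text \<open>The tent is affine between consecutive half-integers, so its second difference there is zero.
  This is what kills the contribution of coarser levels.\<close>

lemma tent_affine:
  assumes "of_int q / 2 \<le> x" "x \<le> (of_int q + 1) / 2" "of_int q / 2 \<le> y" "y \<le> (of_int q + 1) / 2"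
  shows "2 * tent ((x + y) / 2) = tent x + tent y"
proof -
  consider "q \<le> -1" | "q = 0" | "q = 1" | "2 \<le> q" by linarith
  then show ?thesis
  proof cases
    case 1
    then have "x \<le> 0" "y \<le> 0" using assms by auto
    then show ?thesis by (simp add: tent_eq_0)
  next
    case 4
    then have "1 \<le> x" "1 \<le> y" using assms by auto
    then show ?thesis by (simp add: tent_eq_0)
  next
    case 2
    have "tent z = z" if "0 \<le> z" "z \<le> 1 / 2" for z using that by (simp add: tent_def)
    from this[of x] this[of y] this[of "(x + y) / 2"] show ?thesis using 2 assms by simp
  next
    case 3
    have "tent z = 1 - z" if "1 / 2 \<le> z" "z \<le> 1" for z using that by (simp add: tent_def)
    from this[of x] this[of y] this[of "(x + y) / 2"] show ?thesis using 3 assms by (simp add: field_simps)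
  qed
qed

lemma tent_has_derivative:
  assumes "x \<noteq> 0" "x \<noteq> 1 / 2" "x \<noteq> 1"
  shows "(tent has_real_derivative haar_mother x) (at x)"
proof -
  consider "x < 0" | "0 < x" "x < 1 / 2" | "1 / 2 < x" "x < 1" | "1 < x" using assms by linarith
  then show ?thesis
  proof cases
    case 1
    have "((\<lambda>_. 0) has_real_derivative haar_mother x) (at x)"
      using 1 by (simp add: haar_mother_def)
    then show ?thesis
      by (rule has_field_derivative_transform_within_open[where S = "{..<0}"]) (use 1 in \<open>auto simp: tent_def\<close>)
  next
    case 2
    have "((\<lambda>x. x) has_real_derivative haar_mother x) (at x)"
      using 2 by (simp add: haar_mother_def)
    then show ?thesis
      by (rule has_field_derivative_transform_within_open[where S = "{0<..<1/2}"]) (use 2 in \<open>auto simp: tent_def\<close>)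
  next
    case 3
    have "((\<lambda>x. 1 - x) has_real_derivative haar_mother x) (at x)"
      using 3 by (auto simp: haar_mother_def intro!: derivative_eq_intros)
    then show ?thesis
      by (rule has_field_derivative_transform_within_open[where S = "{1/2<..<1}"]) (use 3 in \<open>auto simp: tent_def\<close>)
  next
    case 4
    have "((\<lambda>_. 0) has_real_derivative haar_mother x) (at x)"
      using 4 by (simp add: haar_mother_def)
    then show ?thesis
      by (rule has_field_derivative_transform_within_open[where S = "{1<..}"]) (use 4 in \<open>auto simp: tent_def\<close>)
  qed
qed

text \<open>Away from its three kinks, the rescaled tent has derivative \<open>\<psi>\<^bsub>n,k\<^esub>\<close>, and it vanishes at \<open>0\<close>
  because \<open>k \<ge> 0\<close>.\<close>

lemma faber_schauder_eq_tent:
  assumes "0 \<le> t"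
  shows "faber_schauder (int n) k t = 2 powr (- (real n / 2)) * tent (2 ^ n * t - real k)"
proof -
  define g where "g s = 2 powr (- (real n / 2)) * tent (2 ^ n * s - real k)" for s
  define S where "S = {real k / 2 ^ n, (real k + 1 / 2) / 2 ^ n, (real k + 1) / 2 ^ n}"
  have haar: "haar (int n) k s = 2 powr (- (real n / 2)) * (haar_mother (2 ^ n * s - real k) * 2 ^ n)" for s
  proof -
    have "2 powr (- (real n / 2)) * 2 ^ n = 2 powr (real n / 2)"
      by (simp add: field_simps flip: powr_realpow powr_add)
    then show ?thesis by (simp add: haar_def mult.commute mult.left_commute)
  qed
  have "(haar (int n) k has_integral (g t - g 0)) {0..t}"
  proof (rule fundamental_theorem_of_calculus_interior_strong[where S = S])
    fix s assume "s \<in> {0<..<t} - S"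
    then have "2 ^ n * s - real k \<noteq> 0" "2 ^ n * s - real k \<noteq> 1 / 2" "2 ^ n * s - real k \<noteq> 1"
      by (auto simp: S_def field_simps)
    note d = tent_has_derivative[OF this]
    have "(g has_real_derivative haar (int n) k s) (at s)"
      unfolding g_def haar
      by (intro DERIV_cmult DERIV_chain2[where f = tent and g = "\<lambda>s. 2 ^ n * s - real k", OF d]) (auto intro!: derivative_eq_intros)
    then show "(g has_vector_derivative haar (int n) k s) (at s)"
      by (simp add: has_real_derivative_iff_has_vector_derivative)
  next
    show "continuous_on {0..t} g"
      unfolding g_def
      by (intro continuous_intros continuous_on_compose2[OF continuous_on_tent[of UNIV]]) auto
  qed (use assms in \<open>auto simp: S_def\<close>)
  then have "faber_schauder (int n) k t = g t - g 0"
    unfolding faber_schauder_def by (rule integral_unique)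
  then show ?thesis by (simp add: g_def tent_eq_0)
qed

lemma faber_schauder_minus_one:
  assumes "t \<in> {0..1}"
  shows "faber_schauder (-1) k t = t"
proof -
  have "integral {0..t} (haar (-1) k) = integral {0..t} (\<lambda>_. 1)"
    using assms by (intro integral_cong) (auto simp: haar_def)
  then show ?thesis using assms by (simp add: faber_schauder_def)
qed

lemma level_idx_int [simp]: "level_idx (int n) = {..<2 ^ n}" "level_idx (-1) = {0}"
  by (auto simp: level_idx_def)

lemma finite_level_idx [simp]: "finite (level_idx n)"
  by (simp add: level_idx_def)

lemma level_idx_cases [consumes 1, case_names minus_one nat]:
  assumes "k \<in> level_idx n"
  obtains "n = -1" "k = 0" | m where "n = int m" "k < 2 ^ m"
  using assms by (cases n rule: int_cases3) (auto simp: level_idx_def split: if_splits)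

lemma dyadic_int: "dyadic (int n) k = real k / 2 ^ n" "dyadic (int n + 1) k = real k / 2 ^ Suc n"
proof -
  show *: "dyadic (int n) k = real k / 2 ^ n" for n
    by (simp add: dyadic_def power_int_minus field_simps)
  show "dyadic (int n + 1) k = real k / 2 ^ Suc n"
    using *[of "Suc n"] by (simp add: add.commute)
qed

lemma fs_coeff_nat:
  assumes "k < 2 ^ n"
  shows "fs_coeff f (int n) k = 2 powr (real n / 2) *
    (2 * f ((2 * real k + 1) / 2 ^ Suc n) - f (real k / 2 ^ n) - f ((real k + 1) / 2 ^ n))"
  using assms dyadic_int(2)[of n "2 * k + 1"] dyadic_int(1)[of n "k + 1"]
  by (simp add: fs_coeff_def dyadic_int(1) add.commute)

lemma fs_coeff_minus_one: "fs_coeff f (-1) 0 = f 1 - f 0"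
  by (simp add: fs_coeff_def)

lemma fs_coeff_not_level: "k \<notin> level_idx n \<Longrightarrow> fs_coeff f n k = 0"
  by (simp add: fs_coeff_def)

lemma dyadic_points_in_unit:
  assumes "k < 2 ^ n"
  shows "(2 * real k + 1) / 2 ^ Suc n \<in> {0..1}" "real k / 2 ^ n \<in> {0..1}" "(real k + 1) / 2 ^ n \<in> {0..1}"
proof -
  have "real (Suc k) \<le> real (2 ^ n)" using assms by (intro of_nat_mono) simp
  then have "real k + 1 \<le> 2 ^ n" by simp
  then show "(2 * real k + 1) / 2 ^ Suc n \<in> {0..1}" "real k / 2 ^ n \<in> {0..1}" "(real k + 1) / 2 ^ n \<in> {0..1}"
    using assms by (auto simp: divide_le_eq)
qed

text \<open>Biorthogonality for levels \<open>n\<close> and \<open>m\<close>, both nonnegative. In the coordinate \<open>2\<^bsup>n\<^esup> t - k\<close> the dyadic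
  points that define \<open>\<theta>\<^bsub>m,j\<^esub>\<close> are all integers if \<open>m < n\<close>; two integers and a half-integer if
  \<open>m = n\<close>; and points of one half-integer interval if \<open>m > n\<close>.\<close>

lemma fs_coeff_faber_schauder_nat:
  assumes k: "k < 2 ^ n" and j: "j < 2 ^ m"
  shows "fs_coeff (faber_schauder (int n) k) (int m) j = (if n = m \<and> k = j then 1 else 0)"
proof -
  let ?l = "2 ^ n * (real j / 2 ^ m) - real k" and ?r = "2 ^ n * ((real j + 1) / 2 ^ m) - real k"
    and ?c = "2 ^ n * ((2 * real j + 1) / 2 ^ Suc m) - real k"
  have eq: "fs_coeff (faber_schauder (int n) k) (int m) j = 2 powr (real m / 2) *
      (2 powr (- (real n / 2)) * (2 * tent ?c - tent ?l - tent ?r))"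
    using dyadic_points_in_unit[OF j] by (simp add: fs_coeff_nat[OF j] faber_schauder_eq_tent algebra_simps)
  consider "n = m" | d where "n = Suc (m + d)" | d where "m = Suc (n + d)"
    by (metis less_iff_Suc_add linorder_neqE_nat)
  then show ?thesis
  proof cases
    case 1
    have "?l = of_int (int j - int k)" "?r = of_int (int j + 1 - int k)"
      using 1 by simp_all
    then have lr: "tent ?l = 0" "tent ?r = 0" by (metis tent_of_int)+
    have c: "?c = real j - real k + 1 / 2" using 1 by (simp add: field_simps)
    have "tent ?c = (if k = j then 1 / 2 else 0)"
    proof (cases k j rule: linorder_cases)
      case less
      then show ?thesis unfolding c by (simp add: tent_eq_0)
    next
      case greater
      then have "real j + 1 \<le> real k" by simp
      then show ?thesis unfolding c using greater by (simp add: tent_eq_0)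
    qed (unfold c, simp add: tent_def)
    then show ?thesis
      unfolding eq lr using 1 by (simp flip: powr_add)
  next
    case 2
    have "?l = of_int (2 ^ Suc d * int j - int k)" "?r = of_int (2 ^ Suc d * (int j + 1) - int k)"
      "?c = of_int (2 ^ d * (2 * int j + 1) - int k)"
      using 2 by (simp_all add: power_add field_simps)
    then have "tent ?l = 0" "tent ?r = 0" "tent ?c = 0" by (metis tent_of_int)+
    then show ?thesis unfolding eq using 2 by simp
  next
    case 3
    \<comment> \<open>\<open>[i/2, (i+1)/2]\<close> is the half-integer interval that contains \<open>[?l + k, ?r + k]\<close>\<close>
    define i where "i = j div 2 ^ d"
    have i: "i * 2 ^ d \<le> j" "j + 1 \<le> (i + 1) * 2 ^ d"
      using div_mult_mod_eq[of j "2 ^ d"] mod_less_divisor[of "2 ^ d" j] unfolding i_def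
      by (auto simp del: mod_less_divisor)
    have i': "real i * 2 ^ d \<le> real j" "real j + 1 \<le> (real i + 1) * 2 ^ d"
      using of_nat_mono[OF i(1), where 'a = real] of_nat_mono[OF i(2), where 'a = real] by (simp_all add: algebra_simps)
    have p: "(2::real) ^ m = 2 ^ n * 2 ^ d * 2" using 3 by (simp add: power_add)
    let ?q = "int i - 2 * int k"
    define u where "u = real j / 2 ^ d"
    define v where "v = (real j + 1) / 2 ^ d"
    have lr: "?l = u / 2 - real k" "?r = v / 2 - real k"
      unfolding p u_def v_def by (simp_all add: field_simps)
    have "real i \<le> u" "u \<le> v" "v \<le> real i + 1"
      using i' by (simp_all add: u_def v_def field_simps)
    then have "2 * tent ((?l + ?r) / 2) = tent ?l + tent ?r"
      unfolding lr by (intro tent_affine[of ?q]) auto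
    also have "(?l + ?r) / 2 = ?c" by (simp add: field_simps)
    finally show ?thesis unfolding eq using 3 by simp
  qed
qed

text \<open>The additional level \<open>-1\<close> consists of the identity on the unit interval, which is affine, and its
  functional \<open>f 1 - f 0\<close> annihilates every tent.\<close>

lemma fs_coeff_faber_schauder:
  assumes "k \<in> level_idx n" "j \<in> level_idx m"
  shows "fs_coeff (faber_schauder n k) m j = (if n = m \<and> k = j then 1 else 0)"
  using assms(1)
proof (cases rule: level_idx_cases)
  case n: minus_one
  show ?thesis
    using assms(2)
  proof (cases rule: level_idx_cases)
    case minus_one
    then show ?thesis using n by (simp add: fs_coeff_minus_one faber_schauder_minus_one)
  next
    case (nat m')
    then show ?thesis using n dyadic_points_in_unit[OF nat(2)]
      by (simp add: fs_coeff_nat faber_schauder_minus_one field_simps)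
  qed
next
  case n: (nat n')
  show ?thesis
    using assms(2)
  proof (cases rule: level_idx_cases)
    case minus_one
    have "2 ^ n' - real k = of_int (2 ^ n' - int k)" by simp
    then have "tent (2 ^ n' - real k) = 0" by (metis tent_of_int)
    then show ?thesis using n minus_one
      by (simp add: fs_coeff_minus_one faber_schauder_eq_tent tent_eq_0)
  next
    case (nat m')
    then show ?thesis using n by (simp add: fs_coeff_faber_schauder_nat)
  qed
qed

lemma linear_fs_coeff: "linear fs_coeff"
  by (rule linearI) (auto simp: fun_eq_iff fs_coeff_def scaleR_fun_def algebra_simps)

lemma sum_fun_apply: "(\<Sum>i\<in>A. f i) x = (\<Sum>i\<in>A. f i x)"
  by (induction A rule: infinite_finite_induct) simp_all

lemma fs_coeff_fs_level:
  assumes "j \<in> level_idx m"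
  shows "fs_coeff (fs_level a n) m j = (if n = m then a m j else 0)"
proof -
  have "fs_level a n = (\<Sum>k\<in>level_idx n. a n k *\<^sub>R faber_schauder n k)"
    by (auto simp: fs_level_def fun_eq_iff scaleR_fun_def sum_fun_apply)
  then have "fs_coeff (fs_level a n) = (\<Sum>k\<in>level_idx n. a n k *\<^sub>R fs_coeff (faber_schauder n k))"
    by (simp add: linear_sum[OF linear_fs_coeff] linear_scale[OF linear_fs_coeff])
  then have "fs_coeff (fs_level a n) m j = (\<Sum>k\<in>level_idx n. a n k * fs_coeff (faber_schauder n k) m j)"
    by (simp add: scaleR_fun_def sum_fun_apply)
  also have "\<dots> = (\<Sum>k\<in>level_idx n. if n = m \<and> k = j then a n k else 0)"
    using assms by (intro sum.cong refl) (simp add: fs_coeff_faber_schauder)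
  also have "\<dots> = (if n = m then a m j else 0)"
    using assms by (cases "n = m") simp_all
  finally show ?thesis .
qed

text \<open>A Faber--Schauder coefficient depends on finitely many values of the function, hence commutes with
  pointwise convergent series.\<close>

lemma fs_coeff_sums:
  assumes "\<And>t. t \<in> {0..1} \<Longrightarrow> (\<lambda>i. g i t) sums f t"
  shows "(\<lambda>i. fs_coeff (g i) n k) sums fs_coeff f n k"
proof (cases "k \<in> level_idx n")
  case True
  then show ?thesis
  proof (cases rule: level_idx_cases)
    case (nat m)
    then show ?thesis using assms dyadic_points_in_unit[OF nat(2)]
      unfolding nat(1) fs_coeff_nat[OF nat(2)]
      by (intro sums_mult sums_diff) auto
  next
    case minus_one
    then show ?thesis using assms by (auto simp: fs_coeff_minus_one intro!: sums_diff)
  qed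
qed (simp add: fs_coeff_not_level)

text \<open>At most one translate, the one with \<open>k = \<lfloor>x\<rfloor>\<close>, is nonzero at \<open>x\<close>.\<close>

lemma sum_tent_le_1:
  assumes "finite F"
  shows "(\<Sum>k\<in>F. tent (x - real k)) \<le> 1"
proof -
  have "(\<Sum>k\<in>F. tent (x - real k)) = (\<Sum>k\<in>F \<inter> {nat \<lfloor>x\<rfloor>}. tent (x - real k))"
  proof (rule sum.mono_neutral_right[OF assms])
    show "\<forall>k\<in>F - F \<inter> {nat \<lfloor>x\<rfloor>}. tent (x - real k) = 0"
    proof
      fix k assume "k \<in> F - F \<inter> {nat \<lfloor>x\<rfloor>}"
      then have "int k \<noteq> \<lfloor>x\<rfloor>" by auto
      then have "\<not> (real k \<le> x \<and> x < real k + 1)" by (metis floor_unique of_int_of_nat_eq)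
      then show "tent (x - real k) = 0" by (intro tent_eq_0) auto
    qed
  qed auto
  also have "\<dots> \<le> 1" by (cases "nat \<lfloor>x\<rfloor> \<in> F") (auto simp: tent_le_1)
  finally show ?thesis .
qed

lemma abs_fs_level_le:
  assumes "0 \<le> t"
  shows "\<bar>fs_level a (int n) t\<bar> \<le> 2 powr (- (real n / 2)) * (SUP k\<in>level_idx (int n). \<bar>a (int n) k\<bar>)"
proof -
  define M where "M = (SUP k\<in>level_idx (int n). \<bar>a (int n) k\<bar>)"
  have M: "\<bar>a (int n) k\<bar> \<le> M" if "k < 2 ^ n" for k
    unfolding M_def using that by (intro cSUP_upper) auto
  have "0 \<le> M" using M[of 0] by auto
  have "\<bar>fs_level a (int n) t\<bar> \<le> (\<Sum>k<2 ^ n. \<bar>a (int n) k * faber_schauder (int n) k t\<bar>)"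
    unfolding fs_level_def by (simp add: sum_abs)
  also have "\<dots> \<le> (\<Sum>k<2 ^ n. M * (2 powr (- (real n / 2)) * tent (2 ^ n * t - real k)))"
    using M \<open>0 \<le> M\<close> assms by (intro sum_mono) (auto simp: faber_schauder_eq_tent abs_mult tent_nonneg intro!: mult_right_mono)
  also have "\<dots> = M * 2 powr (- (real n / 2)) * (\<Sum>k<2 ^ n. tent (2 ^ n * t - real k))"
    by (simp add: sum_distrib_left mult.assoc)
  also have "\<dots> \<le> M * 2 powr (- (real n / 2)) * 1"
    using \<open>0 \<le> M\<close> by (intro mult_left_mono sum_tent_le_1) auto
  finally show ?thesis by (simp add: M_def mult.commute)
qed

lemma continuous_on_fs_level: "continuous_on {0..1} (fs_level a n)"
proof -
  have "continuous_on {0..1} (faber_schauder n k)" if "k \<in> level_idx n" for k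
    using that
  proof (cases rule: level_idx_cases)
    case minus_one
    have "continuous_on {0..1} (\<lambda>t::real. t)" by simp
    then show ?thesis
      unfolding minus_one by (rule continuous_on_eq) (simp add: faber_schauder_minus_one)
  next
    case (nat m)
    have "continuous_on {0..1} (\<lambda>t. 2 powr (- (real m / 2)) * tent (2 ^ m * t - real k))"
      by (intro continuous_intros continuous_on_compose2[OF continuous_on_tent[of UNIV]]) auto
    then show ?thesis
      unfolding nat by (rule continuous_on_eq) (simp add: faber_schauder_eq_tent)
  qed
  then show ?thesis unfolding fs_level_def by (intro continuous_intros) auto
qed

text \<open>A vanishing coefficient forces the value at a midpoint to be the average of the values at the
  neighbouring points one level coarser.\<close>

lemma fs_coeff_eq_0_imp_dyadic_eq_0:
  assumes "f 0 = 0" "fs_coeff f = 0" "k \<le> 2 ^ n"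
  shows "f (real k / 2 ^ n) = 0"
  using assms(3)
proof (induction n arbitrary: k)
  case 0
  have "fs_coeff f (-1) 0 = 0" using assms(2) by simp
  then have "f 1 = 0" using assms(1) by (simp add: fs_coeff_minus_one)
  moreover have "k = 0 \<or> k = 1" using 0 by auto
  ultimately show ?case using assms(1) by auto
next
  case (Suc n)
  show ?case
  proof (cases "even k")
    case True
    then obtain i where "k = 2 * i" by blast
    then show ?thesis using Suc.IH[of i] Suc.prems by simp
  next
    case False
    then obtain i where i: "k = 2 * i + 1" using oddE by blast
    then have "i < 2 ^ n" using Suc.prems by auto
    moreover have "fs_coeff f (int n) i = 0" using assms(2) by simp
    ultimately show ?thesis
      using Suc.IH[of i] Suc.IH[of "i + 1"] i by (simp add: fs_coeff_nat add.commute)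
  qed
qed

lemma fs_coeff_eq_0_imp_eq_0:
  assumes "f \<in> C01" "f 0 = 0" "fs_coeff f = 0"
  shows "f = 0"
proof
  fix t
  show "f t = 0 t"
  proof (cases "t \<in> {0..1}")
    case True
    define s where "s n = real (nat \<lfloor>2 ^ n * t\<rfloor>) / 2 ^ n" for n
    have s: "t - (1 / 2) ^ n \<le> s n" "s n \<le> t" for n
    proof -
      have "real (nat \<lfloor>2 ^ n * t\<rfloor>) = of_int \<lfloor>2 ^ n * t\<rfloor>" using True by simp
      then have "2 ^ n * t - 1 \<le> real (nat \<lfloor>2 ^ n * t\<rfloor>)" "real (nat \<lfloor>2 ^ n * t\<rfloor>) \<le> 2 ^ n * t"
        by linarith+
      then have "(2 ^ n * t - 1) / 2 ^ n \<le> s n" "s n \<le> (2 ^ n * t) / 2 ^ n"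
        unfolding s_def by (intro divide_right_mono; simp)+
      then show "t - (1 / 2) ^ n \<le> s n" "s n \<le> t"
        by (simp_all add: diff_divide_distrib power_one_over)
    qed
    have "s \<longlonglongrightarrow> t"
    proof (rule tendsto_sandwich[OF _ _ _ tendsto_const])
      show "(\<lambda>n. t - (1 / 2) ^ n) \<longlonglongrightarrow> t"
        using tendsto_diff[OF tendsto_const LIMSEQ_realpow_zero[of "1 / 2"], of t] by simp
    qed (use s in auto)
    moreover have s01: "s n \<in> {0..1}" for n
    proof -
      have "0 \<le> s n" by (simp add: s_def)
      then show ?thesis using s(2)[of n] True by auto
    qed
    ultimately have "(\<lambda>n. f (s n)) \<longlonglongrightarrow> f t"
      using assms(1) True by (intro continuous_on_tendsto_compose[of "{0..1}" f]) (auto simp: C01_def)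
    moreover have "f (s n) = 0" for n
    proof -
      have "real (nat \<lfloor>2 ^ n * t\<rfloor>) \<le> real (2 ^ n)"
        using s01[of n] by (simp add: s_def divide_le_eq del: of_nat_nat)
      then show ?thesis
        unfolding s_def by (intro fs_coeff_eq_0_imp_dyadic_eq_0[OF assms(2,3)]) (simp only: of_nat_le_iff)
    qed
    ultimately show ?thesis by (simp add: LIMSEQ_const_iff)
  qed (use assms(1) in \<open>simp add: C01_def\<close>)
qed

section \<open>The energy spaces as normed spaces\<close>

text \<open>The topology on function types is the product topology.\<close>

lemma tendsto_fun_iff:
  fixes f :: "'a \<Rightarrow> 'i \<Rightarrow> 'b::topological_space"
  shows "(f \<longlongrightarrow> l) F \<longleftrightarrow> (\<forall>i. ((\<lambda>x. f x i) \<longlongrightarrow> l i) F)"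
  using limitin_componentwise[of "\<lambda>_. euclidean" UNIV f l F]
  by (simp add: euclidean_product_topology limitin_canonical_iff)

lemma continuous_on_coeff: "continuous_on UNIV (\<lambda>a::int \<Rightarrow> nat \<Rightarrow> real. a n k)"
  by (rule continuous_on_product_then_coordinatewise[OF continuous_on_product_coordinates])

lemma lsc_seminorm_coeff: "lsc_seminorm (\<lambda>a::int \<Rightarrow> nat \<Rightarrow> real. ennreal \<bar>w * a n k\<bar>)"
proof (rule lsc_seminorm_abs)
  show "linear (\<lambda>a::int \<Rightarrow> nat \<Rightarrow> real. w * a n k)"
    by (rule linearI) (simp_all add: scaleR_fun_def algebra_simps)
  show "continuous_on UNIV (\<lambda>a::int \<Rightarrow> nat \<Rightarrow> real. w * a n k)"
    by (rule continuous_on_mult_left[OF continuous_on_coeff])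
qed

lemma zeta_coeff_minus_one:
  "ennreal (zeta_coeff p a (-1)) = ennreal \<bar>2 powr (1 - 1 / p) * a (-1) 0\<bar>"
  by (simp add: zeta_coeff_def abs_mult)

lemma zeta_coeff_eq_lp_norm:
  assumes "0 < p" "n \<noteq> -1"
  shows "ennreal (zeta_coeff p a n) =
    lp_norm p (level_idx n) (\<lambda>k. ennreal \<bar>2 powr (- (of_int n / 2)) * a n k\<bar>)"
  using assms unfolding lp_norm_finite_real[OF finite_level_idx assms(1)]
  by (simp add: zeta_coeff_def abs_mult powr_mult powr_powr sum_distrib_left)

text \<open>A sum is an \<open>\<ell>\<^sup>1\<close> norm. Moving the weight inside the absolute value turns it into part of the
  linear functional, so that scaling needs no closure rule of its own. The real supremum agrees with
  the extended one because every level \<open>m \<ge> 0\<close> is finite and nonempty.\<close>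

lemma H_coeff_eq_lp_norm:
  assumes "0 \<le> n"
  shows "H_coeff a n = lp_norm 1 {n..} (\<lambda>m. SUP k\<in>level_idx m. ennreal \<bar>2 powr (- (of_int m / 2)) * a m k\<bar>)"
  unfolding H_coeff_def infsum_eq_lp_norm[symmetric]
proof (rule infsum_cong)
  fix m assume m: "m \<in> {n..}"
  then have "0 \<in> level_idx m" using assms by (simp add: level_idx_def)
  then have ne: "level_idx m \<noteq> {}" by blast
  have "ennreal (SUP k\<in>level_idx m. \<bar>a m k\<bar>) = (SUP k\<in>level_idx m. ennreal \<bar>a m k\<bar>)"
    using ne mono_Max_commute[of ennreal "(\<lambda>k. \<bar>a m k\<bar>) ` level_idx m"]
    by (simp add: cSup_eq_Max image_image monoI ennreal_leI)
  then show "ennreal (2 powr (- (of_int m / 2)) * (SUP k\<in>level_idx m. \<bar>a m k\<bar>))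
      = (SUP k\<in>level_idx m. ennreal \<bar>2 powr (- (of_int m / 2)) * a m k\<bar>)"
    by (simp add: abs_mult ennreal_mult' SUP_mult_left_ennreal)
qed

lemma lsc_seminorm_zeta_lp:
  assumes "1 \<le> p"
  shows "lsc_seminorm (zeta_lp p)"
proof -
  have "lsc_seminorm (\<lambda>a. ennreal (zeta_coeff p a n))" for n
  proof (cases "n = -1")
    case True
    then show ?thesis by (simp only: zeta_coeff_minus_one lsc_seminorm_coeff)
  next
    case False
    have p0: "0 < p" using assms by simp
    show ?thesis
      unfolding zeta_coeff_eq_lp_norm[OF p0 False]
      by (intro lsc_seminorm_lp_norm lsc_seminorm_coeff assms)
  qed
  then have "lsc_seminorm (\<lambda>a. zeta_lp p a)"
    unfolding zeta_lp_def using assms by (intro lsc_seminorm_lp_norm)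
  then show ?thesis by simp
qed

lemma lsc_seminorm_H_lp:
  assumes "1 \<le> p"
  shows "lsc_seminorm (H_lp p)"
proof -
  have "lsc_seminorm (\<lambda>a. H_coeff a n)" if "0 \<le> n" for n
    unfolding H_coeff_eq_lp_norm[OF that]
    by (intro lsc_seminorm_lp_norm lsc_seminorm_SUP lsc_seminorm_coeff) auto
  then have "lsc_seminorm (\<lambda>a. H_lp p a)"
    unfolding H_lp_def using assms by (intro lsc_seminorm_lp_norm) auto
  then show ?thesis by simp
qed

text \<open>The weight \<open>w\<close> depends on the level but not on the family \<open>a\<close>; this makes a Cauchy sequence of
  families Cauchy in every coefficient.\<close>

lemma coeff_le_zeta_lp:
  assumes "1 \<le> p" "k \<in> level_idx n"
  shows "\<exists>w>0. \<forall>a. ennreal (w * \<bar>a n k\<bar>) \<le> zeta_lp p a"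
proof -
  have p0: "0 < p" using assms by simp
  have n: "n \<in> {-1..}" using assms(2) by (cases rule: level_idx_cases) auto
  have *: "ennreal (zeta_coeff p a n) \<le> zeta_lp p a" for a
    unfolding zeta_lp_def using p0 n by (rule le_lp_norm)
  define w :: real where "w = (if n = -1 then 2 powr (1 - 1 / p) else 2 powr (- (of_int n / 2)))"
  have "ennreal (w * \<bar>a n k\<bar>) \<le> ennreal (zeta_coeff p a n)" for a
  proof (cases "n = -1")
    case True
    then show ?thesis using assms(2) by (simp add: zeta_coeff_minus_one w_def abs_mult)
  next
    case False
    then show ?thesis
      using le_lp_norm[OF p0 assms(2), of "\<lambda>k. ennreal \<bar>2 powr (- (of_int n / 2)) * a n k\<bar>"]
      by (simp add: zeta_coeff_eq_lp_norm[OF p0] w_def abs_mult)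
  qed
  then have "\<forall>a. ennreal (w * \<bar>a n k\<bar>) \<le> zeta_lp p a" using * order_trans by blast
  moreover have "0 < w" by (simp add: w_def)
  ultimately show ?thesis by blast
qed

text \<open>The factor \<open>2\<^bsup>1-1/p\<^esup>\<close> in \<open>\<zeta>(-1)\<close> is at least \<open>1\<close>.\<close>

lemma abs_coeff_minus_one_le_zeta_lp:
  assumes "1 \<le> p"
  shows "ennreal \<bar>a (-1) 0\<bar> \<le> zeta_lp p a"
proof -
  have "1 \<le> 2 powr (1 - 1 / p)" using assms by (intro ge_one_powr_ge_zero) auto
  then have "ennreal \<bar>a (-1) 0\<bar> \<le> ennreal (zeta_coeff p a (-1))"
    unfolding zeta_coeff_minus_one by (intro ennreal_leI) (simp add: abs_mult mult_le_cancel_right1)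
  also have "\<dots> \<le> zeta_lp p a"
    unfolding zeta_lp_def using assms by (intro le_lp_norm) auto
  finally show ?thesis .
qed

text \<open>The extended-valued form of the coefficient norm; the space consists of the pairs of a number and
  a coefficient family at which it is finite.\<close>

definition coeff_enorm :: "real \<Rightarrow> real \<times> (int \<Rightarrow> nat \<Rightarrow> real) \<Rightarrow> ennreal" where
  "coeff_enorm p x = ennreal \<bar>fst x\<bar> + zeta_lp p (snd x) + H_lp p (snd x)"

lemma lsc_seminorm_coeff_enorm:
  assumes "1 \<le> p"
  shows "lsc_seminorm (coeff_enorm p)"
proof -
  note snd = lsc_seminorm_compose[OF _ linear_snd continuous_on_snd[OF continuous_on_id]]
  have "lsc_seminorm (\<lambda>x. coeff_enorm p x)"
    unfolding coeff_enorm_def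
    by (intro lsc_seminorm_add lsc_seminorm_abs[OF linear_fst continuous_on_fst[OF continuous_on_id]]
        snd[OF lsc_seminorm_zeta_lp[OF assms]] snd[OF lsc_seminorm_H_lp[OF assms]])
  then show ?thesis by simp
qed

lemma coeff_energy_space_eq:
  "coeff_energy_space p = {x \<in> UNIV \<times> coeff_families. coeff_enorm p x < \<infinity>}"
  by (auto simp: coeff_energy_space_def coeff_enorm_def)

lemma coeff_energy_norm_eq:
  assumes "x \<in> coeff_energy_space p"
  shows "coeff_energy_norm p x = enn2real (coeff_enorm p x)"
  using assms by (auto simp: coeff_energy_space_def coeff_energy_norm_def coeff_enorm_def enn2real_plus)

lemma subspace_coeff_families: "subspace (UNIV \<times> coeff_families)"
  by (auto simp: subspace_def coeff_families_def scaleR_fun_def scaleR_prod_def zero_prod_def)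

lemma coeff_le_coeff_enorm:
  assumes "1 \<le> p"
  shows "\<exists>w>0. \<forall>x \<in> UNIV \<times> coeff_families. ennreal (w * \<bar>snd x n k\<bar>) \<le> coeff_enorm p x"
proof (cases "k \<in> level_idx n")
  case True
  then obtain w where w: "0 < w" "\<And>a. ennreal (w * \<bar>a n k\<bar>) \<le> zeta_lp p a"
    using coeff_le_zeta_lp[OF assms] by blast
  have "zeta_lp p (snd x) \<le> coeff_enorm p x" for x
    unfolding coeff_enorm_def by (simp add: add_increasing add_increasing2)
  then show ?thesis using w order_trans by blast
next
  case False
  then show ?thesis by (intro exI[of _ 1]) (auto simp: coeff_families_def)
qed

lemma coeff_enorm_eq_0:
  assumes "1 \<le> p" "x \<in> UNIV \<times> coeff_families" "coeff_enorm p x = 0"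
  shows "x = 0"
proof -
  have "snd x n k = 0" for n k
  proof -
    obtain w where "0 < w" "ennreal (w * \<bar>snd x n k\<bar>) \<le> coeff_enorm p x"
      using coeff_le_coeff_enorm[OF assms(1)] assms(2) by blast
    then show ?thesis using assms(3) by (simp add: ennreal_eq_0_iff mult_le_0_iff)
  qed
  moreover have "fst x = 0" using assms(3) by (simp add: coeff_enorm_def)
  ultimately show ?thesis by (auto simp: prod_eq_iff fun_eq_iff)
qed

lemma Cauchy_of_weighted_bound:
  fixes u :: "nat \<Rightarrow> real"
  assumes "0 < w" and le: "\<And>i j. ennreal (w * \<bar>u i - u j\<bar>) \<le> B i j"
    and B: "\<And>e. 0 < e \<Longrightarrow> \<exists>M. \<forall>i\<ge>M. \<forall>j\<ge>M. B i j < ennreal e"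
  shows "convergent u"
proof -
  have "Cauchy u"
  proof (rule CauchyI)
    fix e :: real assume e: "0 < e"
    then obtain M where M: "\<And>i j. i \<ge> M \<Longrightarrow> j \<ge> M \<Longrightarrow> B i j < ennreal (w * e)"
      using B[of "w * e"] assms(1) by auto
    have "norm (u i - u j) < e" if "i \<ge> M" "j \<ge> M" for i j
    proof -
      have "ennreal (w * \<bar>u i - u j\<bar>) < ennreal (w * e)"
        using le M[OF that] by (rule le_less_trans)
      then show ?thesis using assms(1) by (simp add: ennreal_less_iff)
    qed
    then show "\<exists>M. \<forall>m\<ge>M. \<forall>n\<ge>M. norm (u m - u n) < e" by blast
  qed
  then show ?thesis by (simp add: Cauchy_convergent_iff)
qed

text \<open>The norm controls every coefficient, so a Cauchy sequence has a coefficientwise limit, which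
  again vanishes off the index sets.\<close>

lemma banach_coeff_energy_space:
  assumes p: "1 \<le> p"
  shows "banach_space_on (coeff_energy_space p) (coeff_energy_norm p)"
proof (rule banach_space_on_lsc_seminorm[OF lsc_seminorm_coeff_enorm[OF p] subspace_coeff_families _ _ coeff_energy_space_eq])
  fix s :: "nat \<Rightarrow> real \<times> (int \<Rightarrow> nat \<Rightarrow> real)"
  assume s: "\<And>i. s i \<in> UNIV \<times> coeff_families"
    and c: "\<And>e. 0 < e \<Longrightarrow> \<exists>M. \<forall>i\<ge>M. \<forall>j\<ge>M. coeff_enorm p (s i - s j) < ennreal e"
  have diff: "s i - s j \<in> UNIV \<times> coeff_families" for i j
    by (rule subspace_diff[OF subspace_coeff_families s s])
  have "convergent (\<lambda>i. fst (s i))"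
  proof (rule Cauchy_of_weighted_bound[of 1, OF _ _ c])
    show "ennreal (1 * \<bar>fst (s i) - fst (s j)\<bar>) \<le> coeff_enorm p (s i - s j)" for i j
      unfolding coeff_enorm_def by (simp add: add_increasing2)
  qed auto
  moreover have "convergent (\<lambda>i. snd (s i) n k)" for n k
  proof -
    have sub: "snd (s i - s j) n k = snd (s i) n k - snd (s j) n k" for i j
      by (simp add: snd_diff)
    obtain w where w: "0 < w" "\<And>x. x \<in> UNIV \<times> coeff_families \<Longrightarrow> ennreal (w * \<bar>snd x n k\<bar>) \<le> coeff_enorm p x"
      using coeff_le_coeff_enorm[OF p] by blast
    show ?thesis
      by (rule Cauchy_of_weighted_bound[OF w(1) w(2)[OF diff, unfolded sub] c])
  qed
  ultimately obtain c0 a where lim: "(\<lambda>i. fst (s i)) \<longlonglongrightarrow> c0" "\<And>n k. (\<lambda>i. snd (s i) n k) \<longlonglongrightarrow> a n k"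
    unfolding convergent_def by metis
  have "a n k = 0" if "k \<notin> level_idx n" for n k
  proof -
    have "snd (s i) n k = 0" for i using s[of i] that by (auto simp: coeff_families_def)
    then show ?thesis using lim(2)[of n k] by (simp add: LIMSEQ_const_iff)
  qed
  then have "(c0, a) \<in> UNIV \<times> coeff_families" by (simp add: coeff_families_def)
  moreover have "(\<lambda>j. s i - s j) \<longlonglongrightarrow> s i - (c0, a)" for i
  proof -
    have "(\<lambda>j. (fst (s i) - fst (s j), snd (s i) - snd (s j))) \<longlonglongrightarrow> (fst (s i) - c0, snd (s i) - a)"
      using lim by (intro tendsto_Pair tendsto_diff tendsto_const)
        (auto simp: tendsto_fun_iff intro!: tendsto_diff)
    then show ?thesis by (simp add: minus_prod_def)
  qed
  ultimately show "\<exists>l\<in>UNIV \<times> coeff_families. \<forall>i. (\<lambda>j. s i - s j) \<longlonglongrightarrow> s i - l" by blast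
qed (use coeff_enorm_eq_0[OF p] coeff_energy_norm_eq in blast)+

lemma continuous_on_fs_coeff: "continuous_on UNIV fs_coeff"
proof (intro continuous_on_coordinatewise_then_product)
  fix n k
  show "continuous_on UNIV (\<lambda>f. fs_coeff f n k)"
    unfolding fs_coeff_def
    by (cases "k \<in> level_idx n"; cases "n = -1") (auto intro!: continuous_intros)
qed

lemma lsc_seminorm_energy_enorm:
  assumes "1 \<le> p"
  shows "lsc_seminorm (energy_enorm p)"
proof -
  have "lsc_seminorm (\<lambda>f::real \<Rightarrow> real. ennreal \<bar>f t\<bar>)" for t
    by (rule lsc_seminorm_abs) (auto intro: linearI simp: scaleR_fun_def)
  moreover note coeff = lsc_seminorm_compose[OF _ linear_fs_coeff continuous_on_fs_coeff]
  ultimately have "lsc_seminorm (\<lambda>f. energy_enorm p f)"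
    unfolding energy_enorm_def
    by (intro lsc_seminorm_add lsc_seminorm_SUP coeff[OF lsc_seminorm_zeta_lp[OF assms]]
        coeff[OF lsc_seminorm_H_lp[OF assms]])
  then show ?thesis by simp
qed

lemma subspace_C01: "subspace C01"
  by (auto simp: subspace_def C01_def scaleR_fun_def plus_fun_def zero_fun_def intro!: continuous_intros)

lemma normed_energy_space:
  assumes "1 \<le> p"
  shows "normed_space_on (energy_space p) (energy_norm p)"
proof (rule normed_space_on_lsc_seminorm[OF lsc_seminorm_energy_enorm[OF assms] subspace_C01])
  fix f assume f: "f \<in> C01" "energy_enorm p f = 0"
  have "f t = 0" for t
  proof (cases "t \<in> {0..1}")
    case True
    then have "ennreal \<bar>f t\<bar> \<le> (SUP t\<in>{0..1}. ennreal \<bar>f t\<bar>)" by (rule SUP_upper)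
    then show ?thesis using f(2) by (simp add: energy_enorm_def)
  qed (use f in \<open>simp add: C01_def\<close>)
  then show "f = 0" by auto
qed (auto simp: energy_space_def energy_norm_def)

section \<open>Convergence of the Faber--Schauder series\<close>

definition level_sup :: "(int \<Rightarrow> nat \<Rightarrow> real) \<Rightarrow> int \<Rightarrow> real" where
  "level_sup a n = 2 powr (- (of_int n / 2)) * (SUP k\<in>level_idx n. \<bar>a n k\<bar>)"

lemma level_sup_nonneg: "0 \<le> level_sup a (int n)"
proof -
  have "\<bar>a (int n) 0\<bar> \<le> (SUP k\<in>level_idx (int n). \<bar>a (int n) k\<bar>)"
    by (intro cSUP_upper) auto
  then show ?thesis unfolding level_sup_def by (intro mult_nonneg_nonneg) auto
qed

text \<open>The weighted suprema are the terms of the series \<open>H\<^sub>a(0)\<close>.\<close>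

lemma sum_level_sup_le:
  "ennreal (\<Sum>n<N. level_sup a (int n)) \<le> H_coeff a 0"
proof -
  have "ennreal (\<Sum>n<N. level_sup a (int n)) = (\<Sum>n<N. ennreal (level_sup a (int n)))"
    by (simp add: sum_ennreal level_sup_nonneg)
  also have "\<dots> = (\<Sum>m\<in>int ` {..<N}. ennreal (level_sup a m))"
    by (simp add: sum.reindex)
  also have "\<dots> \<le> (\<Sum>\<^sub>\<infinity>m\<in>{0..}. ennreal (level_sup a m))"
    unfolding nonneg_infsum_complete[OF zero_le]
    by (intro SUP_upper) auto
  finally show ?thesis by (simp add: H_coeff_def level_sup_def)
qed

text \<open>The majorant for the Weierstrass test. The series is indexed by \<open>j = n + 1\<close>, so \<open>0\<close> stands for level
  \<open>-1\<close>.\<close>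

definition level_bound :: "(int \<Rightarrow> nat \<Rightarrow> real) \<Rightarrow> nat \<Rightarrow> real" where
  "level_bound a j = (case j of 0 \<Rightarrow> \<bar>a (-1) 0\<bar> | Suc n \<Rightarrow> level_sup a (int n))"

lemma abs_fs_level_le_level_bound:
  assumes "t \<in> {0..1}"
  shows "\<bar>fs_level a (int j - 1) t\<bar> \<le> level_bound a j"
proof (cases j)
  case 0
  have "\<bar>a (-1) 0\<bar> * t \<le> \<bar>a (-1) 0\<bar> * 1" using assms by (intro mult_left_mono) auto
  then show ?thesis using 0 assms
    by (simp add: fs_level_def faber_schauder_minus_one level_bound_def abs_mult)
next
  case (Suc n)
  then show ?thesis using abs_fs_level_le[of t a n] assms
    by (simp add: level_bound_def level_sup_def)
qed

lemma level_bound_summable: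
  assumes "H_coeff a 0 < \<infinity>"
  shows "summable (level_bound a)"
    and "(\<Sum>j. level_bound a j) \<le> \<bar>a (-1) 0\<bar> + enn2real (H_coeff a 0)"
proof -
  have "(\<Sum>n<N. level_sup a (int n)) \<le> enn2real (H_coeff a 0)" for N
    using sum_level_sup_le[of a N] assms by (cases "H_coeff a 0") (auto simp: ennreal_le_iff)
  then have s: "summable (\<lambda>n. level_sup a (int n))"
    and le: "(\<Sum>n. level_sup a (int n)) \<le> enn2real (H_coeff a 0)"
    by (auto intro!: summableI_nonneg_bounded suminf_le_const level_sup_nonneg)
  show sb: "summable (level_bound a)"
    using s by (subst summable_Suc_iff[symmetric]) (simp add: level_bound_def)
  show "(\<Sum>j. level_bound a j) \<le> \<bar>a (-1) 0\<bar> + enn2real (H_coeff a 0)"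
  proof -
    have "(\<Sum>n. level_bound a (Suc n)) = (\<Sum>n. level_sup a (int n))" "level_bound a 0 = \<bar>a (-1) 0\<bar>"
      by (simp_all add: level_bound_def)
    then show ?thesis using suminf_split_head[OF sb] le by simp
  qed
qed

lemma summable_fs_level:
  assumes "H_coeff a 0 < \<infinity>" "t \<in> {0..1}"
  shows "summable (\<lambda>j. fs_level a (int j - 1) t)"
  using abs_fs_level_le_level_bound[OF assms(2), of a]
  by (intro summable_comparison_test'[OF level_bound_summable(1)[OF assms(1)], of 0])
    (simp only: real_norm_def)

text \<open>The series converges uniformly by the Weierstrass test.\<close>

lemma reconstruction_map_C01:
  assumes "H_coeff a 0 < \<infinity>"
  shows "reconstruction_map (c, a) \<in> C01"
proof -
  have "uniform_limit {0..1} (\<lambda>n t. \<Sum>j<n. fs_level a (int j - 1) t) (\<lambda>t. \<Sum>j. fs_level a (int j - 1) t) sequentially"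
    using abs_fs_level_le_level_bound level_bound_summable(1)[OF assms]
    by (intro Weierstrass_m_test[where M = "level_bound a"]) auto
  then have "continuous_on {0..1} (\<lambda>t. \<Sum>j. fs_level a (int j - 1) t)"
    by (rule uniform_limit_theorem[rotated])
      (auto intro!: always_eventually continuous_on_sum continuous_on_fs_level)
  then have "continuous_on {0..1} (\<lambda>t. c + (\<Sum>j. fs_level a (int j - 1) t))"
    by (intro continuous_intros)
  then have "continuous_on {0..1} (reconstruction_map (c, a))"
    by (rule continuous_on_eq) (simp add: reconstruction_map_def)
  then show ?thesis by (auto simp: C01_def reconstruction_map_def)
qed

lemma abs_reconstruction_map_le:
  assumes "H_coeff a 0 < \<infinity>" "t \<in> {0..1}"
  shows "\<bar>reconstruction_map (c, a) t\<bar> \<le> \<bar>c\<bar> + \<bar>a (-1) 0\<bar> + enn2real (H_coeff a 0)"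
proof -
  have "\<bar>\<Sum>j. fs_level a (int j - 1) t\<bar> \<le> (\<Sum>j. level_bound a j)"
    using norm_suminf_le[OF _ level_bound_summable(1)[OF assms(1)], of "\<lambda>j. fs_level a (int j - 1) t"]
      abs_fs_level_le_level_bound[OF assms(2)] by simp
  then show ?thesis
    using level_bound_summable(2)[OF assms(1)] assms(2) by (simp add: reconstruction_map_def)
qed

lemma fs_level_at_0: "fs_level a n 0 = 0"
  by (simp add: fs_level_def faber_schauder_def)

text \<open>Taking the coefficient \<open>\<theta>\<^bsub>n,k\<^esub>\<close> term by term leaves only the term of level \<open>n\<close>; the constant \<open>c\<close> has
  zero coefficients and is recovered as the value at \<open>0\<close>, where all \<open>e\<^bsub>n,k\<^esub>\<close> vanish.\<close>

lemma coeff_map_reconstruction_map: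
  assumes "H_coeff a 0 < \<infinity>" "a \<in> coeff_families"
  shows "coeff_map (reconstruction_map (c, a)) = (c, a)"
proof -
  have "fs_coeff (reconstruction_map (c, a)) n k = a n k" for n k
  proof (cases "k \<in> level_idx n")
    case True
    have n: "-1 \<le> n" using True by (cases rule: level_idx_cases) auto
    have "(\<lambda>j. fs_level a (int j - 1) t) sums (reconstruction_map (c, a) t - c)" if "t \<in> {0..1}" for t
      using summable_sums[OF summable_fs_level[OF assms(1) that]] that
      by (simp add: reconstruction_map_def)
    then have "(\<lambda>j. fs_coeff (fs_level a (int j - 1)) n k) sums fs_coeff (\<lambda>t. reconstruction_map (c, a) t - c) n k"
      by (rule fs_coeff_sums)
    also have "(\<lambda>j. fs_coeff (fs_level a (int j - 1)) n k) = (\<lambda>j. if j = nat (n + 1) then a n k else 0)"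
    proof -
      have "int j - 1 = n \<longleftrightarrow> j = nat (n + 1)" for j using n by auto
      then show ?thesis by (simp add: fs_coeff_fs_level[OF True])
    qed
    also have "fs_coeff (\<lambda>t. reconstruction_map (c, a) t - c) n k = fs_coeff (reconstruction_map (c, a)) n k"
      by (simp add: fs_coeff_def)
    finally show ?thesis
      using sums_unique2 sums_single[of "nat (n + 1)" "\<lambda>_. a n k"] by blast
  next
    case False
    then show ?thesis using assms(2) by (simp add: fs_coeff_not_level coeff_families_def)
  qed
  moreover have "reconstruction_map (c, a) 0 = c"
    by (simp add: reconstruction_map_def fs_level_at_0)
  ultimately show ?thesis by (simp add: coeff_map_def fun_eq_iff)
qed

section \<open>The coefficient isomorphism\<close>

lemma linear_coeff_map: "linear coeff_map"
  using linear_add[OF linear_fs_coeff] linear_scale[OF linear_fs_coeff]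
  by (intro linearI) (auto simp: coeff_map_def scaleR_fun_def)

lemma inj_on_coeff_map: "inj_on coeff_map C01"
proof (rule inj_onI)
  fix f g assume fg: "f \<in> C01" "g \<in> C01" "coeff_map f = coeff_map g"
  then have "coeff_map (f - g) = 0" by (simp add: linear_diff[OF linear_coeff_map])
  then have "f - g = 0"
    using subspace_diff[OF subspace_C01 fg(1,2)]
    by (intro fs_coeff_eq_0_imp_eq_0) (auto simp: coeff_map_def zero_prod_def)
  then show "f = g" by simp
qed

lemma coeff_enorm_coeff_map_le: "coeff_enorm p (coeff_map f) \<le> energy_enorm p f"
  unfolding coeff_enorm_def energy_enorm_def coeff_map_def
  by (auto intro!: add_mono SUP_upper)

lemma H_coeff_le_H_lp:
  assumes "1 \<le> p"
  shows "H_coeff a 0 \<le> H_lp p a"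
  unfolding H_lp_def using assms by (intro le_lp_norm) auto

text \<open>The uniform norm of the sum is at most the coefficient norm, and the other two summands of the
  energy norm are unchanged.\<close>

lemma energy_enorm_reconstruction_map_le:
  assumes p: "1 \<le> p" and x: "(c, a) \<in> coeff_energy_space p"
  shows "energy_enorm p (reconstruction_map (c, a)) \<le> 2 * coeff_enorm p (c, a)"
proof -
  have a: "a \<in> coeff_families" "H_lp p a < \<infinity>" using x by (auto simp: coeff_energy_space_def)
  have H: "H_coeff a 0 < \<infinity>" using H_coeff_le_H_lp[OF p] a(2) by (rule le_less_trans)
  have fs: "fs_coeff (reconstruction_map (c, a)) = a"
    using coeff_map_reconstruction_map[OF H a(1)] by (simp add: coeff_map_def)
  have "(SUP t\<in>{0..1}. ennreal \<bar>reconstruction_map (c, a) t\<bar>) \<le> coeff_enorm p (c, a)"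
  proof (rule SUP_least)
    fix t :: real assume "t \<in> {0..1}"
    then have "ennreal \<bar>reconstruction_map (c, a) t\<bar>
        \<le> ennreal (\<bar>c\<bar> + \<bar>a (-1) 0\<bar> + enn2real (H_coeff a 0))"
      by (intro ennreal_leI abs_reconstruction_map_le H)
    also have "\<dots> = ennreal \<bar>c\<bar> + ennreal \<bar>a (-1) 0\<bar> + H_coeff a 0"
      using H by simp
    also have "\<dots> \<le> coeff_enorm p (c, a)"
      unfolding coeff_enorm_def
      using abs_coeff_minus_one_le_zeta_lp[OF p] H_coeff_le_H_lp[OF p] by (intro add_mono) auto
    finally show "ennreal \<bar>reconstruction_map (c, a) t\<bar> \<le> coeff_enorm p (c, a)" .
  qed
  moreover have "zeta_lp p a + H_lp p a \<le> coeff_enorm p (c, a)"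
    by (simp add: coeff_enorm_def add.assoc add_increasing)
  ultimately show ?thesis
    unfolding energy_enorm_def fs add.assoc mult_2 by (rule add_mono)
qed

theorem theorem3p26:
  fixes p :: real
  assumes "p > 1"
  shows "banach_space_isomorphism (energy_space p) (energy_norm p)
           (coeff_energy_space p) (coeff_energy_norm p) coeff_map \<and>
         (\<forall>(c, a) \<in> coeff_energy_space p.
            (\<forall>t\<in>{0..1}. summable (\<lambda>j. fs_level a (int j - 1) t)) \<and>
            inv_into (energy_space p) coeff_map (c, a) = reconstruction_map (c, a))"
proof -
  let ?V = "energy_space p" and ?W = "coeff_energy_space p"
  have p: "1 \<le> p" using assms by simp
  have H: "H_coeff a 0 < \<infinity>" if "(c, a) \<in> ?W" for c a
    using H_coeff_le_H_lp[OF p, of a] that by (auto simp: coeff_energy_space_def)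
  have R: "reconstruction_map (c, a) \<in> ?V" "coeff_map (reconstruction_map (c, a)) = (c, a)"
    if x: "(c, a) \<in> ?W" for c a
  proof -
    have "coeff_enorm p (c, a) < \<infinity>" using x by (simp add: coeff_energy_space_eq)
    then have "energy_enorm p (reconstruction_map (c, a)) < \<infinity>"
      using energy_enorm_reconstruction_map_le[OF p x]
      by (auto simp: ennreal_mult_less_top intro: le_less_trans)
    then show "reconstruction_map (c, a) \<in> ?V"
      using reconstruction_map_C01[OF H[OF x]] by (simp add: energy_space_def)
    show "coeff_map (reconstruction_map (c, a)) = (c, a)"
      using x by (intro coeff_map_reconstruction_map H[OF x]) (auto simp: coeff_energy_space_def)
  qed
  have T: "coeff_map f \<in> ?W" if "f \<in> ?V" for f
  proof -
    have "coeff_enorm p (coeff_map f) < \<infinity>"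
      using coeff_enorm_coeff_map_le[of p f] that by (auto simp: energy_space_def)
    then show ?thesis
      unfolding coeff_energy_space_eq by (auto simp: coeff_map_def coeff_families_def fs_coeff_not_level)
  qed
  have inj: "inj_on coeff_map ?V"
    by (rule inj_on_subset[OF inj_on_coeff_map]) (auto simp: energy_space_def)
  have inv: "inv_into ?V coeff_map (c, a) = reconstruction_map (c, a)" if "(c, a) \<in> ?W" for c a
    using inv_into_f_f[OF inj R(1)[OF that]] R(2)[OF that] by simp
  have "coeff_map ` ?V = ?W"
  proof
    show "?W \<subseteq> coeff_map ` ?V" using R by (force intro: rev_image_eqI)
  qed (use T in auto)
  with inj have bij: "bij_betw coeff_map ?V ?W" by (simp add: bij_betw_def)
  have "coeff_energy_norm p (coeff_map f) \<le> 1 * energy_norm p f" if "f \<in> ?V" for f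
    using that coeff_enorm_coeff_map_le[of p f] unfolding coeff_energy_norm_eq[OF T[OF that]]
    by (auto simp: energy_norm_def energy_space_def intro: enn2real_mono)
  then have bounded: "bounded_linear_between ?V (energy_norm p) ?W (coeff_energy_norm p) coeff_map"
    unfolding bounded_linear_between_def
    using T linear_add[OF linear_coeff_map] linear_scale[OF linear_coeff_map] by blast
  have "energy_norm p f \<le> 2 * coeff_energy_norm p (coeff_map f)" if f: "f \<in> ?V" for f
  proof -
    obtain c a where x: "coeff_map f = (c, a)" by fastforce
    have W: "(c, a) \<in> ?W" using T[OF f] x by simp
    have "f = reconstruction_map (c, a)" using inv[OF W] inv_into_f_f[OF inj f] x by simp
    then have "energy_enorm p f \<le> 2 * coeff_enorm p (c, a)"
      using energy_enorm_reconstruction_map_le[OF p W] by simp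
    moreover have "coeff_enorm p (c, a) < \<infinity>" using W by (simp add: coeff_energy_space_eq)
    ultimately have "enn2real (energy_enorm p f) \<le> enn2real (2 * coeff_enorm p (c, a))"
      by (intro enn2real_mono) (auto simp: ennreal_mult_less_top)
    then show ?thesis
      unfolding x coeff_energy_norm_eq[OF W] energy_norm_def by (simp add: enn2real_mult)
  qed
  then have "banach_space_isomorphism ?V (energy_norm p) ?W (coeff_energy_norm p) coeff_map"
    by (rule banach_space_isomorphismI[OF normed_energy_space[OF p] banach_coeff_energy_space[OF p] bounded bij])
  moreover have "\<forall>t\<in>{0..1}. summable (\<lambda>j. fs_level a (int j - 1) t)" if "(c, a) \<in> ?W" for c a
    using summable_fs_level[OF H[OF that]] by blast
  ultimately show ?thesis using inv by auto
qed

end
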